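(* The 1-bend planar slope number of SP-graphs with maximum vertex-degree $\Delta$ is at most $\Delta$; that is, every SP-graph with maximum vertex-degree $\Delta$ admits a 1-bend planar drawing in which the edge segments use at most $\Delta$ distinct slopes.
   Context: A series-parallel digraph (SP-digraph) is a simple planar digraph with one source and one sink, called its poles, defined recursively as follows. A single directed edge is an SP-digraph. The digraph obtained by identifying the sources and identifying the sinks of two SP-digraphs is an SP-digraph (parallel composition). The digraph obtained by identifying the sink of one SP-digraph with the source of a second SP-digraph is an SP-digraph (series composition). An SP-graph is the underlying undirected graph of an SP-digraph. A 1-bend planar drawing maps vertices to distinct points of the plane and each edge to a polyline consisting of at most two straight-line segments (at most one bend) connecting its end-vertices, such that no two edges cross (edges meet only at common end-vertices and do not pass through other vertices). The planar embedding is not prescribed and can be chosen. The slope of a line $\ell$ is the angle by which a horizontal line must be rotated counter-clockwise in order to overlap with $\ell$; the slope of a segment is the slope of its supporting line. The 1-bend planar slope number of a family of planar graphs with maximum vertex-degree $\Delta$ is the minimum number $k$ such that every graph in the family has a 1-bend planar drawing whose edge segments use at most $k$ distinct slopes. *)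

theory Defs
  imports
    "HOL-Analysis.Analysis"
    "HOL-Library.Extended_Nat"
    "Graph_Theory.Pair_Digraph"
begin

section \<open>Series-parallel digraphs and SP-graphs\<close>

text \<open>
  \<open>sp_digraph D s t\<close>: \<open>D\<close> is an SP-digraph with source \<open>s\<close> and sink \<open>t\<close>. Identifying poles is
  rendered as the union of two digraphs that share exactly the identified poles. A set of pairs
  cannot hold parallel arcs, so in a parallel composition disjointness of the arc sets is what
  excludes compositions whose result would not be simple. Planarity is not a separate clause: the
  compositions preserve it. The remaining properties (finite, loop-free, exactly one source and one
  sink) are derived in \<open>sp_digraph_pair_digraph\<close>, \<open>sp_digraph_source\<close> and \<open>sp_digraph_sink\<close>.
\<close>

inductive sp_digraph :: "'a pair_pre_digraph \<Rightarrow> 'a \<Rightarrow> 'a \<Rightarrow> bool" where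
  edge: "s \<noteq> t \<Longrightarrow> sp_digraph \<lparr>pverts = {s, t}, parcs = {(s, t)}\<rparr> s t"
| parallel: "\<lbrakk>sp_digraph D1 s t; sp_digraph D2 s t;
      pverts D1 \<inter> pverts D2 = {s, t}; parcs D1 \<inter> parcs D2 = {}\<rbrakk> \<Longrightarrow>
    sp_digraph \<lparr>pverts = pverts D1 \<union> pverts D2, parcs = parcs D1 \<union> parcs D2\<rparr> s t"
| series: "\<lbrakk>sp_digraph D1 s m; sp_digraph D2 m t; pverts D1 \<inter> pverts D2 = {m}\<rbrakk> \<Longrightarrow>
    sp_digraph \<lparr>pverts = pverts D1 \<union> pverts D2, parcs = parcs D1 \<union> parcs D2\<rparr> s t"

lemma sp_digraph_basic:
  assumes "sp_digraph D s t"
  shows "s \<in> pverts D" "t \<in> pverts D" "s \<noteq> t" "finite (pverts D)"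
    "parcs D \<subseteq> pverts D \<times> pverts D" "(v, v) \<notin> parcs D"
  using assms by induction auto

lemma sp_digraph_pair_digraph:
  assumes "sp_digraph D s t"
  shows "pair_digraph D"
proof unfold_locales
  note b = sp_digraph_basic[OF assms]
  show "finite (pverts D)" by (rule b(4))
  show "finite (parcs D)" by (rule finite_subset[OF b(5)]) (simp add: b(4))
  fix e assume e: "e \<in> parcs D"
  show "fst e \<in> pverts D" "snd e \<in> pverts D" using subsetD[OF b(5) e] by (auto simp: mem_Times_iff)
  show "fst e \<noteq> snd e" using b(6)[of "fst e"] e by (metis prod.collapse)
qed

lemma sp_digraph_source:
  assumes "sp_digraph D s t" "v \<in> pverts D"
  shows "(\<forall>u. (u, v) \<notin> parcs D) \<longleftrightarrow> v = s"
  using assms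
proof (induction arbitrary: v)
  case (edge s t)
  then show ?case by auto
next
  case (parallel D1 s t D2)
  have 1: "parcs D1 \<subseteq> pverts D1 \<times> pverts D1" "s \<in> pverts D1"
    by (rule sp_digraph_basic[OF parallel.hyps(1)])+
  have 2: "parcs D2 \<subseteq> pverts D2 \<times> pverts D2" "s \<in> pverts D2"
    by (rule sp_digraph_basic[OF parallel.hyps(2)])+
  show ?case
    using 1 2 parallel.IH[of v] parallel.prems
    by (cases "v \<in> pverts D1"; cases "v \<in> pverts D2") auto
next
  case (series D1 s m D2 t)
  have 1: "parcs D1 \<subseteq> pverts D1 \<times> pverts D1" "s \<in> pverts D1" "m \<in> pverts D1" "s \<noteq> m"
    by (rule sp_digraph_basic[OF series.hyps(1)])+
  have 2: "parcs D2 \<subseteq> pverts D2 \<times> pverts D2" "t \<in> pverts D2" "m \<in> pverts D2" "m \<noteq> t"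
    by (rule sp_digraph_basic[OF series.hyps(2)])+
  have int: "x = m" if "x \<in> pverts D1" "x \<in> pverts D2" for x
    using that series.hyps(3) by auto
  have 3: "s \<notin> pverts D2" "t \<notin> pverts D1"
    using int[of s] int[of t] 1(2,4) 2(2,4) by auto
  show ?case
    using 1 2 3 int[of v] series.IH[of v] series.prems
    by (cases "v \<in> pverts D1"; cases "v \<in> pverts D2") auto
qed

lemma sp_digraph_sink:
  assumes "sp_digraph D s t" "v \<in> pverts D"
  shows "(\<forall>u. (v, u) \<notin> parcs D) \<longleftrightarrow> v = t"
  using assms
proof (induction arbitrary: v)
  case (edge s t)
  then show ?case by auto
next
  case (parallel D1 s t D2)
  have 1: "parcs D1 \<subseteq> pverts D1 \<times> pverts D1" "t \<in> pverts D1"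
    by (rule sp_digraph_basic[OF parallel.hyps(1)])+
  have 2: "parcs D2 \<subseteq> pverts D2 \<times> pverts D2" "t \<in> pverts D2"
    by (rule sp_digraph_basic[OF parallel.hyps(2)])+
  show ?case
    using 1 2 parallel.IH[of v] parallel.prems
    by (cases "v \<in> pverts D1"; cases "v \<in> pverts D2") auto
next
  case (series D1 s m D2 t)
  have 1: "parcs D1 \<subseteq> pverts D1 \<times> pverts D1" "s \<in> pverts D1" "m \<in> pverts D1" "s \<noteq> m"
    by (rule sp_digraph_basic[OF series.hyps(1)])+
  have 2: "parcs D2 \<subseteq> pverts D2 \<times> pverts D2" "t \<in> pverts D2" "m \<in> pverts D2" "m \<noteq> t"
    by (rule sp_digraph_basic[OF series.hyps(2)])+
  have int: "x = m" if "x \<in> pverts D1" "x \<in> pverts D2" for x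
    using that series.hyps(3) by auto
  have 3: "s \<notin> pverts D2" "t \<notin> pverts D1"
    using int[of s] int[of t] 1(2,4) 2(2,4) by auto
  show ?case
    using 1 2 3 int[of v] series.IH[of v] series.prems
    by (cases "v \<in> pverts D1"; cases "v \<in> pverts D2") auto
qed

record 'a ugraph =
  uverts :: "'a set"
  uedges :: "'a set set"

definition underlying_ugraph :: "'a pair_pre_digraph \<Rightarrow> 'a ugraph" where
  "underlying_ugraph D = \<lparr>uverts = pverts D, uedges = {{u, v} | u v. (u, v) \<in> parcs D}\<rparr>"

definition sp_graph :: "'a ugraph \<Rightarrow> bool" where
  "sp_graph G \<longleftrightarrow> (\<exists>D s t. sp_digraph D s t \<and> G = underlying_ugraph D)"

definition vertex_degree :: "'a ugraph \<Rightarrow> 'a \<Rightarrow> nat" where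
  "vertex_degree G v = card {e \<in> uedges G. v \<in> e}"

definition max_degree :: "'a ugraph \<Rightarrow> nat" where
  "max_degree G = Max (vertex_degree G ` uverts G)"


section \<open>1-bend planar drawings\<close>

text \<open>
  The plane is \<open>complex\<close>. A drawing is given by the vertex positions \<open>pos\<close> and a map \<open>bend\<close> that
  assigns to each edge its bend point, if any. Edges are two-element sets, so without a bend
  \<open>convex hull (pos ` e)\<close> is the straight-line segment between the two end-vertices, and with a
  bend the image over \<open>e\<close> consists of the two segments from the end-vertices to the bend point.
\<close>

definition edge_segments ::
    "('a \<Rightarrow> complex) \<Rightarrow> ('a set \<Rightarrow> complex option) \<Rightarrow> 'a set \<Rightarrow> complex set set" where
  "edge_segments pos bend e = (case bend e of
      None \<Rightarrow> {convex hull (pos ` e)}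
    | Some b \<Rightarrow> (\<lambda>v. closed_segment (pos v) b) ` e)"

definition edge_curve ::
    "('a \<Rightarrow> complex) \<Rightarrow> ('a set \<Rightarrow> complex option) \<Rightarrow> 'a set \<Rightarrow> complex set" where
  "edge_curve pos bend e = \<Union> (edge_segments pos bend e)"

text \<open>
  The second and third conditions make every segment nondegenerate and every edge a simple curve
  (its two segments meet only at the bend). The fourth says that edges do not pass through other
  vertices, the fifth that distinct edges meet only at common end-vertices.
\<close>

definition one_bend_planar_drawing ::
    "'a ugraph \<Rightarrow> ('a \<Rightarrow> complex) \<Rightarrow> ('a set \<Rightarrow> complex option) \<Rightarrow> bool" where
  "one_bend_planar_drawing G pos bend \<longleftrightarrow>
    inj_on pos (uverts G) \<and>
    (\<forall>e \<in> uedges G. \<forall>b. bend e = Some b \<longrightarrow> b \<notin> pos ` e) \<and>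
    (\<forall>e \<in> uedges G. \<forall>b. bend e = Some b \<longrightarrow>
      (\<forall>u \<in> e. \<forall>v \<in> e. u \<noteq> v \<longrightarrow>
        closed_segment (pos u) b \<inter> closed_segment (pos v) b = {b})) \<and>
    (\<forall>e \<in> uedges G. \<forall>v \<in> uverts G. pos v \<in> edge_curve pos bend e \<longrightarrow> v \<in> e) \<and>
    (\<forall>e \<in> uedges G. \<forall>f \<in> uedges G. e \<noteq> f \<longrightarrow>
      edge_curve pos bend e \<inter> edge_curve pos bend f \<subseteq> pos ` (e \<inter> f))"


section \<open>Slopes\<close>

text \<open>
  \<open>\<real>\<close> is the horizontal axis of the complex plane, \<open>cis \<theta> * x\<close> rotates \<open>x\<close> counter-clockwise
  by \<open>\<theta>\<close>, and the translation by \<open>a\<close> accounts for the choice of the horizontal line and of the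
  centre of rotation. The angle is unique modulo \<open>pi\<close>, hence the range \<open>{0..<pi}\<close>; it exists and
  is unique for every line, see \<open>ex1_line_slope\<close>.
\<close>

definition line_slope :: "complex set \<Rightarrow> real" where
  "line_slope L = (THE \<theta>. \<theta> \<in> {0..<pi} \<and> (\<exists>a. L = (\<lambda>x. a + cis \<theta> * x) ` \<real>))"

lemma ex1_line_slope:
  assumes "p \<noteq> q"
  shows "\<exists>!\<theta>. \<theta> \<in> {0..<pi} \<and> (\<exists>a. affine hull {p, q} = (\<lambda>x. a + cis \<theta> * x) ` \<real>)"
proof -
  have ex: "\<exists>r. q - p = cis \<theta> * of_real r" if "affine hull {p, q} = (\<lambda>x. a + cis \<theta> * x) ` \<real>" for a \<theta>
  proof -
    have "p \<in> (\<lambda>x. a + cis \<theta> * x) ` \<real>" "q \<in> (\<lambda>x. a + cis \<theta> * x) ` \<real>"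
      unfolding that[symmetric] by (auto intro: hull_inc)
    then obtain x y where "p = a + cis \<theta> * of_real x" "q = a + cis \<theta> * of_real y"
      by (auto simp: Reals_def)
    then have "q - p = cis \<theta> * of_real (y - x)" by (simp add: algebra_simps)
    then show ?thesis ..
  qed
  have sin0: "sin (\<phi> - \<theta>) = 0"
    if "q - p = cis \<theta> * of_real r" "q - p = cis \<phi> * of_real r'" for \<theta> \<phi> r r'
  proof -
    have "r' \<noteq> 0" using that assms by auto
    have "cis (\<phi> - \<theta>) * of_real r' = cis (- \<theta>) * (cis \<phi> * of_real r')"
      by (simp add: cis_mult flip: mult.assoc)
    also have "\<dots> = cis (- \<theta>) * (cis \<theta> * of_real r)" using that by simp
    also have "\<dots> = of_real r" by (simp add: cis_mult flip: mult.assoc)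
    finally have "Im (cis (\<phi> - \<theta>) * of_real r') = 0" by simp
    with \<open>r' \<noteq> 0\<close> show ?thesis by simp
  qed
  define t where "t = Arg (q - p)"
  define \<theta> where "\<theta> = (if t < 0 then t + pi else if t = pi then 0 else t)"
  have t: "- pi < t" "t \<le> pi" "q - p = of_real (cmod (q - p)) * cis t"
    using Arg_bounded[of "q - p"] rcis_cmod_Arg[of "q - p"] by (auto simp: t_def rcis_def)
  have "\<theta> \<in> {0..<pi}" using t by (auto simp: \<theta>_def)
  have "cis t = cis \<theta> \<or> cis t = - cis \<theta>"
    by (auto simp: \<theta>_def cis.ctr complex_eq_iff)
  then have "\<exists>r. q - p = cis \<theta> * of_real r"
  proof
    assume "cis t = cis \<theta>"
    with t(3) show ?thesis by (metis mult.commute)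
  next
    assume "cis t = - cis \<theta>"
    with t(3) have "q - p = cis \<theta> * of_real (- cmod (q - p))" by (simp add: mult.commute)
    then show ?thesis ..
  qed
  then obtain r where r: "q - p = cis \<theta> * of_real r" ..
  with assms have "r \<noteq> 0" by auto
  have "affine hull {p, q} = range (\<lambda>u. p + cis \<theta> * of_real (u * r))"
    unfolding affine_hull_2_alt r by (simp add: scaleR_conv_of_real mult_ac)
  also have "\<dots> = (\<lambda>x. p + cis \<theta> * x) ` of_real ` range (\<lambda>u. u * r)"
    by (simp add: image_image)
  also have "range (\<lambda>u. u * r) = UNIV"
    using \<open>r \<noteq> 0\<close> by (intro surjI[where f = "\<lambda>v. v / r"]) simp
  finally have "affine hull {p, q} = (\<lambda>x. p + cis \<theta> * x) ` \<real>" by (simp add: Reals_def)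
  show ?thesis
  proof (rule ex1I[of _ \<theta>])
    show "\<theta> \<in> {0..<pi} \<and> (\<exists>a. affine hull {p, q} = (\<lambda>x. a + cis \<theta> * x) ` \<real>)"
      using \<open>\<theta> \<in> {0..<pi}\<close> \<open>affine hull {p, q} = (\<lambda>x. p + cis \<theta> * x) ` \<real>\<close> by blast
  next
    fix \<phi> assume \<phi>: "\<phi> \<in> {0..<pi} \<and> (\<exists>a. affine hull {p, q} = (\<lambda>x. a + cis \<phi> * x) ` \<real>)"
    then obtain r' where "q - p = cis \<phi> * of_real r'" using ex by blast
    then have s: "sin (\<phi> - \<theta>) = 0" using sin0 r by blast
    have "- pi < \<phi> - \<theta>" "\<phi> - \<theta> < pi" using \<phi> \<open>\<theta> \<in> {0..<pi}\<close> by auto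
    with s show "\<phi> = \<theta>" using sin_eq_0_pi by fastforce
  qed
qed

definition drawing_slopes ::
    "'a ugraph \<Rightarrow> ('a \<Rightarrow> complex) \<Rightarrow> ('a set \<Rightarrow> complex option) \<Rightarrow> real set" where
  "drawing_slopes G pos bend =
    (\<Union>e \<in> uedges G. (\<lambda>S. line_slope (affine hull S)) ` edge_segments pos bend e)"

definition drawable_with_slopes :: "'a ugraph \<Rightarrow> nat \<Rightarrow> bool" where
  "drawable_with_slopes G k \<longleftrightarrow> (\<exists>pos bend. one_bend_planar_drawing G pos bend \<and>
    finite (drawing_slopes G pos bend) \<and> card (drawing_slopes G pos bend) \<le> k)"

text \<open>
  As an infimum in \<open>enat\<close> this is the minimum of the admissible \<open>k\<close> whenever there is one, and
  \<open>\<infinity>\<close> otherwise; a bound by a natural number therefore includes that the minimum exists.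
\<close>

definition one_bend_planar_slope_number :: "'a ugraph set \<Rightarrow> enat" where
  "one_bend_planar_slope_number F = Inf {enat k | k. \<forall>G \<in> F. drawable_with_slopes G k}"

end

theory Submission
  imports Defs
begin

text \<open>
  An SP-digraph has an ordering \<open>f\<close> of its vertices, from source to sink, with a two-page book
  embedding in which every vertex has at most one incoming arc on the first page and at most one
  outgoing arc on the second: in a series composition at \<open>m\<close>, the arcs \<open>(s, m)\<close> and \<open>(m, t)\<close> are put
  on the first and second page, respectively, outside everything else. Put the vertex \<open>v\<close> on the
  diagonal at \<open>(f v, f v)\<close>. An arc of the first page leaves its tail on a steep ray and enters its head
  horizontally, above the diagonal; since it is the only one to do so, no two arcs overlap. The second
  page is the point reflection of this. The steep slopes can be shared by all vertices, so a fan of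
  at most \<open>\<Delta> - 1\<close> arcs per vertex and page costs \<open>\<Delta> - 1\<close> slopes besides the horizontal one. Every
  vertex other than a pole has an arc of either direction, so its fans are that small; at a pole
  one arc is moved to the other page.
\<close>

section \<open>Two-page book embeddings of SP-digraphs\<close>

text \<open>Nested arcs and arcs with a common end are allowed; only strict alternation counts as a
  crossing. As the quantifiers run over ordered pairs of arcs, alternation that starts with the
  other arc is excluded as well.\<close>

definition noncrossing :: "('a \<Rightarrow> 'b::linorder) \<Rightarrow> ('a \<times> 'a) set \<Rightarrow> bool" where
  "noncrossing f E \<longleftrightarrow>
    (\<forall>a b c d. (a, b) \<in> E \<longrightarrow> (c, d) \<in> E \<longrightarrow> \<not> (f a < f c \<and> f c < f b \<and> f b < f d))"

text \<open>Crossing depends on the relative order only, which is how the pages of a component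
  survive the renumbering of vertices in a composition.\<close>

lemma noncrossing_cong:
  assumes "E \<subseteq> V \<times> V" "\<And>u v. u \<in> V \<Longrightarrow> v \<in> V \<Longrightarrow> f u < f v \<longleftrightarrow> g u < g v" "noncrossing g E"
  shows "noncrossing f E"
  unfolding noncrossing_def
proof (intro allI impI)
  fix a b c d assume e: "(a, b) \<in> E" "(c, d) \<in> E"
  then have "a \<in> V" "b \<in> V" "c \<in> V" "d \<in> V" using assms(1) by auto
  then show "\<not> (f a < f c \<and> f c < f b \<and> f b < f d)"
    using assms(2,3) e unfolding noncrossing_def by simp
qed

lemma noncrossing_Un:
  assumes "noncrossing f E" "noncrossing f F"
    and "\<And>a b c d. (a, b) \<in> E \<Longrightarrow> (c, d) \<in> F \<Longrightarrow> \<not> (f a < f c \<and> f c < f b \<and> f b < f d)"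
    and "\<And>a b c d. (a, b) \<in> E \<Longrightarrow> (c, d) \<in> F \<Longrightarrow> \<not> (f c < f a \<and> f a < f d \<and> f d < f b)"
  shows "noncrossing f (E \<union> F)"
  using assms unfolding noncrossing_def by blast

text \<open>
  The arc between the poles is left out, since its page depends on the context: it goes to the
  first page if the next composition is a series composition at \<open>t\<close>, to the second if at \<open>s\<close>.
\<close>

definition two_page ::
    "'a pair_pre_digraph \<Rightarrow> 'a \<Rightarrow> 'a \<Rightarrow> ('a \<Rightarrow> int) \<Rightarrow> ('a \<times> 'a) set \<Rightarrow> ('a \<times> 'a) set \<Rightarrow> bool" where
  "two_page D s t f E F \<longleftrightarrow>
    inj_on f (pverts D) \<and> (\<forall>v \<in> pverts D. f s \<le> f v \<and> f v \<le> f t) \<and>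
    (\<forall>(u, v) \<in> parcs D. f u < f v) \<and>
    E \<union> F = parcs D - {(s, t)} \<and> E \<inter> F = {} \<and>
    noncrossing f E \<and> noncrossing f F \<and>
    inj_on snd E \<and> inj_on fst F \<and> s \<notin> fst ` F \<and> t \<notin> snd ` E"

lemma inj_on_sndI: "(\<And>a c d. (a, d) \<in> E \<Longrightarrow> (c, d) \<in> E \<Longrightarrow> a = c) \<Longrightarrow> inj_on snd E"
  by (force simp: inj_on_def)

lemma inj_on_fstI: "(\<And>a b d. (a, b) \<in> E \<Longrightarrow> (a, d) \<in> E \<Longrightarrow> b = d) \<Longrightarrow> inj_on fst E"
  by (force simp: inj_on_def)

lemma two_pageD:
  assumes "two_page D s t f E F"
  shows "inj_on f (pverts D)"
    and "v \<in> pverts D \<Longrightarrow> f s \<le> f v" "v \<in> pverts D \<Longrightarrow> f v \<le> f t"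
    and "(u, v) \<in> parcs D \<Longrightarrow> f u < f v"
    and "E \<union> F = parcs D - {(s, t)}" "E \<inter> F = {}"
    and "noncrossing f E" "noncrossing f F"
    and "inj_on snd E" "inj_on fst F"
    and "(u, v) \<in> E \<Longrightarrow> v \<noteq> t" "(u, v) \<in> F \<Longrightarrow> u \<noteq> s"
    and "E \<subseteq> parcs D" "F \<subseteq> parcs D"
  using assms unfolding two_page_def by (auto simp: image_iff)

lemma two_pageI:
  assumes "inj_on f (pverts D)" "\<And>v. v \<in> pverts D \<Longrightarrow> f s \<le> f v" "\<And>v. v \<in> pverts D \<Longrightarrow> f v \<le> f t"
    and "\<And>u v. (u, v) \<in> parcs D \<Longrightarrow> f u < f v"
    and "E \<union> F = parcs D - {(s, t)}" "E \<inter> F = {}" "noncrossing f E" "noncrossing f F"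
    and "inj_on snd E" "inj_on fst F"
    and "\<And>u v. (u, v) \<in> E \<Longrightarrow> v \<noteq> t" "\<And>u v. (u, v) \<in> F \<Longrightarrow> u \<noteq> s"
  shows "two_page D s t f E F"
proof -
  have "s \<notin> fst ` F" "t \<notin> snd ` E" using assms(11,12) by force+
  then show ?thesis using assms(1-10) unfolding two_page_def by auto
qed

lemma two_page_strict:
  assumes "two_page D s t f E F" "sp_digraph D s t" "v \<in> pverts D"
  shows "v \<noteq> s \<Longrightarrow> f s < f v" "v \<noteq> t \<Longrightarrow> f v < f t"
  using assms sp_digraph_basic(1,2)[OF assms(2)] two_pageD(1-3)[OF assms(1)]
  by (metis inj_onD order_le_less)+

text \<open>The new order is \<open>s\<close>, the inner vertices of \<open>D1\<close>, those of
  \<open>D2\<close>, \<open>t\<close>, with negative values up to the end of \<open>D1\<close> and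
  positive ones after it. First-page arcs avoid the head \<open>t\<close>, so those of
  \<open>D1\<close> stay among the negative values, while those of \<open>D2\<close> start at
  \<open>s\<close> or among the positive ones; hence they are nested or apart. The second page is
  dual, with the tail \<open>s\<close> avoided.\<close>

lemma two_page_parallel:
  assumes sp: "sp_digraph D1 s t" "sp_digraph D2 s t"
    and V: "pverts D1 \<inter> pverts D2 = {s, t}" and A: "parcs D1 \<inter> parcs D2 = {}"
    and tp1: "two_page D1 s t f1 E1 F1" and tp2: "two_page D2 s t f2 E2 F2"
  defines "f \<equiv> \<lambda>v. if v \<in> pverts D1 - {t} then f1 v - f1 t else f2 v - f2 s"
  shows "two_page \<lparr>pverts = pverts D1 \<union> pverts D2, parcs = parcs D1 \<union> parcs D2\<rparr> s t f
    (E1 \<union> E2) (F1 \<union> F2)"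
proof -
  note b1 = sp_digraph_basic[OF sp(1)] and b2 = sp_digraph_basic[OF sp(2)]
  note d1 = two_pageD[OF tp1] and d2 = two_pageD[OF tp2]
  note s1 = two_page_strict[OF tp1 sp(1)] and s2 = two_page_strict[OF tp2 sp(2)]
  have neg: "f v < 0" if "v \<in> pverts D1" "v \<noteq> t" for v
    using s1[of v] that by (simp add: f_def)
  have pos: "f v > 0" if "v \<in> pverts D2" "v \<noteq> s" for v
  proof -
    have "v \<notin> pverts D1 - {t}" using V that by auto
    then show ?thesis using s2[of v] that by (simp add: f_def)
  qed
  have ord1: "f u < f v \<longleftrightarrow> f1 u < f1 v" if "u \<in> pverts D1" "v \<in> pverts D1" for u v
    using that s1[of u] s1[of v] neg[of u] neg[of v] pos[of t] b1(3) b2(2)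
    by (cases "u = t"; cases "v = t") (auto simp: f_def)
  have ord2: "f u < f v \<longleftrightarrow> f2 u < f2 v" if "u \<in> pverts D2" "v \<in> pverts D2" for u v
  proof (cases "u = s \<or> v = s")
    case True
    then show ?thesis
      using that s2[of u] s2[of v] neg[of s] pos[of u] pos[of v] b1(1,3) by fastforce
  next
    case False
    then have "u \<notin> pverts D1 - {t}" "v \<notin> pverts D1 - {t}" using V that by auto
    then have "f u = f2 u - f2 s" "f v = f2 v - f2 s" unfolding f_def by (simp_all only: if_False)
    then show ?thesis by simp
  qed
  have sub1: "E1 \<subseteq> parcs D1" "F1 \<subseteq> parcs D1" and sub2: "E2 \<subseteq> parcs D2" "F2 \<subseteq> parcs D2"
    using d1(13,14) d2(13,14) by auto
  have mem1: "u \<in> pverts D1 \<and> v \<in> pverts D1" if "(u, v) \<in> E1 \<or> (u, v) \<in> F1" for u v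
    using that sub1 b1(5) by blast
  have mem2: "u \<in> pverts D2 \<and> v \<in> pverts D2" if "(u, v) \<in> E2 \<or> (u, v) \<in> F2" for u v
    using that sub2 b2(5) by auto
  have pole1: "v \<noteq> t" if "(u, v) \<in> E1" for u v using that two_pageD(11,12)[OF tp1] by blast
  have pole2: "v \<noteq> t" if "(u, v) \<in> E2" for u v using that two_pageD(11,12)[OF tp2] by blast
  have pole3: "u \<noteq> s" if "(u, v) \<in> F1" for u v using that two_pageD(11,12)[OF tp1] by blast
  have pole4: "u \<noteq> s" if "(u, v) \<in> F2" for u v using that two_pageD(11,12)[OF tp2] by blast
  have fwd1: "f u < f v" if "(u, v) \<in> parcs D1" for u v
    using d1(4)[OF that] ord1[of u v] b1(5) that by blast
  have fwd2: "f u < f v" if "(u, v) \<in> parcs D2" for u v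
    using d2(4)[OF that] ord2[of u v] b2(5) that by blast
  have le: "f s \<le> f v" "f v \<le> f t" if "v \<in> pverts D1 \<union> pverts D2" for v
  proof -
    have "\<not> f v < f s \<and> \<not> f t < f v"
    proof (cases "v \<in> pverts D1")
      case True
      then show ?thesis using ord1[of v s] ord1[of t v] b1(1,2) d1(2,3)[of v] by simp
    next
      case False
      with that have "v \<in> pverts D2" by simp
      then show ?thesis using ord2[of v s] ord2[of t v] b2(1,2) d2(2,3)[of v] by simp
    qed
    then show "f s \<le> f v" "f v \<le> f t" by auto
  qed
  have inj: "inj_on f (pverts D1 \<union> pverts D2)"
  proof (rule inj_onI)
    fix u v assume uv: "u \<in> pverts D1 \<union> pverts D2" "v \<in> pverts D1 \<union> pverts D2" "f u = f v"
    have j1: "u = v" if "u \<in> pverts D1" "v \<in> pverts D1"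
      
    proof -
      have "f1 u = f1 v" using ord1[OF that] ord1[OF that(2,1)] uv(3) by linarith
      then show "u = v" using d1(1) that by (auto dest: inj_onD)
    qed
    have j2: "u = v" if "u \<in> pverts D2" "v \<in> pverts D2"
      
    proof -
      have "f2 u = f2 v" using ord2[OF that] ord2[OF that(2,1)] uv(3) by linarith
      then show "u = v" using d2(1) that by (auto dest: inj_onD)
    qed
    show "u = v"
      using j1 j2 uv neg[of u] neg[of v] pos[of u] pos[of v] b1(1,2) b2(1,2) by fastforce
  qed
  have ncE: "noncrossing f (E1 \<union> E2)"
  proof (rule noncrossing_Un)
    show "noncrossing f E1"
      by (rule noncrossing_cong[of _ "pverts D1" _ f1]) (use mem1 ord1 d1(7,8) in auto)
    show "noncrossing f E2"
      by (rule noncrossing_cong[of _ "pverts D2" _ f2]) (use mem2 ord2 d2(7,8) in auto)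
    fix a b c d assume e: "(a, b) \<in> E1" "(c, d) \<in> E2"
    show "\<not> (f a < f c \<and> f c < f b \<and> f b < f d)"
      using e mem1[of a b] mem2[of c d] pole1 neg[of b] pos[of c] le(1)[of a] by fastforce
    show "\<not> (f c < f a \<and> f a < f d \<and> f d < f b)"
      using e mem1[of a b] mem2[of c d] pole1 neg[of b] pos[of d] le(1)[of c] fwd2[of c d] sub2
        le(1)[of a] by fastforce
  qed
  have ncF: "noncrossing f (F1 \<union> F2)"
  proof (rule noncrossing_Un)
    show "noncrossing f F1"
      by (rule noncrossing_cong[of _ "pverts D1" _ f1]) (use mem1 ord1 d1(7,8) in auto)
    show "noncrossing f F2"
      by (rule noncrossing_cong[of _ "pverts D2" _ f2]) (use mem2 ord2 d2(7,8) in auto)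
    fix a b c d assume e: "(a, b) \<in> F1" "(c, d) \<in> F2"
    show "\<not> (f a < f c \<and> f c < f b \<and> f b < f d)"
      using e mem1[of a b] mem2[of c d] pole4 neg[of b] pos[of c] le(2)[of d] by fastforce
    show "\<not> (f c < f a \<and> f a < f d \<and> f d < f b)"
      using e mem1[of a b] mem2[of c d] pole4 neg[of a] pos[of c] le(2)[of d] by fastforce
  qed
  have inE: "inj_on snd (E1 \<union> E2)"
  proof (rule inj_on_sndI)
    fix a c d assume "(a, d) \<in> E1 \<union> E2" "(c, d) \<in> E1 \<union> E2"
    \<comment> \<open>A common head would be a common vertex other than \<open>t\<close>, hence
      \<open>s\<close>, which no arc enters.\<close>
    moreover have False if "(a, d) \<in> E1" "(c, d) \<in> E2" for a c d
    proof -
      have "d \<in> pverts D1 \<inter> pverts D2" using mem1[of a d] mem2[of c d] that by simp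
      then have "d = s" using V pole1[OF that(1)] by simp
      then show False using fwd2[of c d] le(1)[of c] mem2[of c d] that sub2 by auto
    qed
    ultimately show "a = c" using inj_onD[OF d1(9), of "(a, d)" "(c, d)"] inj_onD[OF d2(9), of "(a, d)" "(c, d)"] by auto
  qed
  have inF: "inj_on fst (F1 \<union> F2)"
  proof (rule inj_on_fstI)
    fix a b d assume "(a, b) \<in> F1 \<union> F2" "(a, d) \<in> F1 \<union> F2"
    moreover have False if "(a, b) \<in> F1" "(a, d) \<in> F2" for a b d
    proof -
      have "a \<in> pverts D1 \<inter> pverts D2" using mem1[of a b] mem2[of a d] that by simp
      then have "a = t" using V pole3[OF that(1)] by simp
      then show False using fwd1[of a b] le(2)[of b] mem1[of a b] that sub1 by auto
    qed
    ultimately show "b = d" using inj_onD[OF d1(10), of "(a, b)" "(a, d)"] inj_onD[OF d2(10), of "(a, b)" "(a, d)"] by auto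
  qed
  have "E1 \<union> E2 \<union> (F1 \<union> F2) = (E1 \<union> F1) \<union> (E2 \<union> F2)" by (simp add: Un_ac)
  also have "\<dots> = parcs D1 \<union> parcs D2 - {(s, t)}" unfolding d1(5) d2(5) by (simp add: Un_Diff)
  finally have un: "E1 \<union> E2 \<union> (F1 \<union> F2) = parcs D1 \<union> parcs D2 - {(s, t)}" .
  have "E1 \<inter> F2 = {}" "E2 \<inter> F1 = {}"
    using Int_mono[OF sub1(1) sub2(2)] Int_mono[OF sub2(1) sub1(2)] A by (simp_all add: Int_commute)
  with d1(6) d2(6) have disj: "(E1 \<union> E2) \<inter> (F1 \<union> F2) = {}"
    by (simp add: Int_Un_distrib Int_Un_distrib2 Int_commute)
  show ?thesis
  proof (rule two_pageI; (simp only: pair_pre_digraph.simps)?)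
    show "f s \<le> f v" "f v \<le> f t" if "v \<in> pverts D1 \<union> pverts D2" for v by (rule le[OF that])+
    show "f u < f v" if "(u, v) \<in> parcs D1 \<union> parcs D2" for u v using that fwd1 fwd2 by blast
    show "v \<noteq> t" if "(u, v) \<in> E1 \<union> E2" for u v using that pole1 pole2 by blast
    show "u \<noteq> s" if "(u, v) \<in> F1 \<union> F2" for u v using that pole3 pole4 by blast
  qed (fact inj un disj ncE ncF inE inF)+
qed

text \<open>\<open>D1\<close> precedes \<open>D2\<close>, with \<open>m\<close> at 0. Here the arcs
  between the poles of the components, if present, are assigned their pages: \<open>E1\<close> has
  no arc into \<open>m\<close>, so \<open>(s, m)\<close> may join the first page, and
  \<open>F2\<close> has no arc out of \<open>m\<close>, so \<open>(m, t)\<close> may join the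
  second. Each of them spans its whole component. An arc \<open>(s, t)\<close> cannot occur, since
  no component contains both \<open>s\<close> and \<open>t\<close>.\<close>

lemma two_page_series:
  assumes sp: "sp_digraph D1 s m" "sp_digraph D2 m t"
    and V: "pverts D1 \<inter> pverts D2 = {m}"
    and tp1: "two_page D1 s m f1 E1 F1" and tp2: "two_page D2 m t f2 E2 F2"
  defines "f \<equiv> \<lambda>v. if v \<in> pverts D1 then f1 v - f1 m else f2 v - f2 m"
  shows "two_page \<lparr>pverts = pverts D1 \<union> pverts D2, parcs = parcs D1 \<union> parcs D2\<rparr> s t f
    (E1 \<union> E2 \<union> (parcs D1 \<inter> {(s, m)})) (F1 \<union> F2 \<union> (parcs D2 \<inter> {(m, t)}))"
proof -
  note b1 = sp_digraph_basic[OF sp(1)] and b2 = sp_digraph_basic[OF sp(2)]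
  note d1 = two_pageD[OF tp1] and d2 = two_pageD[OF tp2]
  note s1 = two_page_strict[OF tp1 sp(1)] and s2 = two_page_strict[OF tp2 sp(2)]
  have f1: "f v = f1 v - f1 m" if "v \<in> pverts D1" for v using that by (simp add: f_def)
  have f2: "f v = f2 v - f2 m" if "v \<in> pverts D2" for v
    using that V by (cases "v = m") (auto simp: f_def)
  have neg: "f v < 0" if "v \<in> pverts D1" "v \<noteq> m" for v using s1[of v] that f1[of v] by simp
  have neg': "f v \<le> 0" if "v \<in> pverts D1" for v using neg[of v] that f1[of v] by fastforce
  have pos: "f v > 0" if "v \<in> pverts D2" "v \<noteq> m" for v using s2[of v] that f2[of v] by simp
  have pos': "f v \<ge> 0" if "v \<in> pverts D2" for v using pos[of v] that f2[of v] by fastforce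
  have st: "s \<notin> pverts D2" "t \<notin> pverts D1"
    using b1(1,3) b2(2,3) equalityD1[OF V] by (metis IntI singletonD subsetD)+
  have sub1: "E1 \<subseteq> parcs D1" "F1 \<subseteq> parcs D1" and sub2: "E2 \<subseteq> parcs D2" "F2 \<subseteq> parcs D2"
    using d1(13,14) d2(13,14) by auto
  have mem1: "u \<in> pverts D1 \<and> v \<in> pverts D1" if "(u, v) \<in> parcs D1" for u v
    using that b1(5) by auto
  have mem2: "u \<in> pverts D2 \<and> v \<in> pverts D2" if "(u, v) \<in> parcs D2" for u v
    using that b2(5) by auto
  have pole1: "v \<noteq> m" if "(u, v) \<in> E1" for u v using that two_pageD(11,12)[OF tp1] by blast
  have pole2: "v \<noteq> t" if "(u, v) \<in> E2" for u v using that two_pageD(11,12)[OF tp2] by blast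
  have pole3: "u \<noteq> s" if "(u, v) \<in> F1" for u v using that two_pageD(11,12)[OF tp1] by blast
  have pole4: "u \<noteq> m" if "(u, v) \<in> F2" for u v using that two_pageD(11,12)[OF tp2] by blast
  have fwd1: "f u < f v" if "(u, v) \<in> parcs D1" for u v
    using d1(4)[OF that] f1[of u] f1[of v] mem1[OF that] by simp
  have fwd2: "f u < f v" if "(u, v) \<in> parcs D2" for u v
    using d2(4)[OF that] f2[of u] f2[of v] mem2[OF that] by simp
  have le1: "f s \<le> f v" if "v \<in> pverts D1" for v
    using d1(2)[OF that] f1[of s] f1[of v] b1(1) that by simp
  have le2: "f v \<le> f t" if "v \<in> pverts D2" for v
    using d2(3)[OF that] f2[of t] f2[of v] b2(2) that by simp
  have le: "f s \<le> f v" "f v \<le> f t" if "v \<in> pverts D1 \<union> pverts D2" for v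
    using that le1[of v] le2[of v] neg'[of v] neg'[of s] pos'[of v] pos'[of t] b1(1) b2(2) by auto
  have inj: "inj_on f (pverts D1 \<union> pverts D2)"
  proof (rule inj_onI)
    fix u v assume uv: "u \<in> pverts D1 \<union> pverts D2" "v \<in> pverts D1 \<union> pverts D2" "f u = f v"
    have j1: "u = v" if "u \<in> pverts D1" "v \<in> pverts D1"
      
    proof -
      have "f1 u = f1 v" using f1[OF that(1)] f1[OF that(2)] uv(3) by linarith
      then show "u = v" using d1(1) that by (auto dest: inj_onD)
    qed
    have j2: "u = v" if "u \<in> pverts D2" "v \<in> pverts D2"
      
    proof -
      have "f2 u = f2 v" using f2[OF that(1)] f2[OF that(2)] uv(3) by linarith
      then show "u = v" using d2(1) that by (auto dest: inj_onD)
    qed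
    show "u = v"
      using j1 j2 uv neg[of u] neg[of v] pos[of u] pos[of v] b1(2) b2(1) by fastforce
  qed
  have nc: "noncrossing f X1 \<and> noncrossing f X2 \<and> noncrossing f (X1 \<union> X2)"
    if "X1 \<subseteq> parcs D1" "X2 \<subseteq> parcs D2" "noncrossing f1 X1" "noncrossing f2 X2" for X1 X2
  proof -
    have *: "noncrossing f X1"
      by (rule noncrossing_cong[of _ "pverts D1" _ f1]) (use that mem1 f1 in auto)
    moreover have **: "noncrossing f X2"
      by (rule noncrossing_cong[of _ "pverts D2" _ f2]) (use that mem2 f2 in auto)
    moreover have "noncrossing f (X1 \<union> X2)"
    proof (rule noncrossing_Un[OF * **])
      fix a b c d assume e: "(a, b) \<in> X1" "(c, d) \<in> X2"
      have m: "f a \<le> 0" "f b \<le> 0" "0 \<le> f c" "0 \<le> f d"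
        using e that(1,2) mem1[of a b] mem2[of c d] neg' pos' by auto
      then show "\<not> (f a < f c \<and> f c < f b \<and> f b < f d)" "\<not> (f c < f a \<and> f a < f d \<and> f d < f b)"
        by auto
    qed
    ultimately show ?thesis by blast
  qed
  have ncE: "noncrossing f (E1 \<union> E2 \<union> (parcs D1 \<inter> {(s, m)}))"
  proof (rule noncrossing_Un)
    show "noncrossing f (E1 \<union> E2)" using nc sub1 sub2 d1(7,8) d2(7,8) by blast
    show "noncrossing f (parcs D1 \<inter> {(s, m)})" by (auto simp: noncrossing_def)
    fix a b c d assume e: "(a, b) \<in> E1 \<union> E2" "(c, d) \<in> parcs D1 \<inter> {(s, m)}"
    \<comment> \<open>No arc of a component passes strictly over \<open>m\<close>, and none starts
      before \<open>s\<close>, so \<open>(s, m)\<close> is crossed by nothing.\<close>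
    have "f a \<ge> f s" and "f b \<le> f m \<or> f a \<ge> f m"
      using e sub1 sub2 mem1[of a b] mem2[of a b] le[of a] neg'[of b] pos'[of a] b1(2) f1[of m]
      by auto
    then show "\<not> (f a < f c \<and> f c < f b \<and> f b < f d)" "\<not> (f c < f a \<and> f a < f d \<and> f d < f b)"
      using e by auto
  qed
  have ncF: "noncrossing f (F1 \<union> F2 \<union> (parcs D2 \<inter> {(m, t)}))"
  proof (rule noncrossing_Un)
    show "noncrossing f (F1 \<union> F2)" using nc sub1 sub2 d1(7,8) d2(7,8) by blast
    show "noncrossing f (parcs D2 \<inter> {(m, t)})" by (auto simp: noncrossing_def)
    fix a b c d assume e: "(a, b) \<in> F1 \<union> F2" "(c, d) \<in> parcs D2 \<inter> {(m, t)}"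
    have "f b \<le> f t" and "f b \<le> f m \<or> f a \<ge> f m"
      using e sub1 sub2 mem1[of a b] mem2[of a b] le[of b] neg'[of b] pos'[of a] b1(2) f1[of m]
      by auto
    then show "\<not> (f a < f c \<and> f c < f b \<and> f b < f d)" "\<not> (f c < f a \<and> f a < f d \<and> f d < f b)"
      using e by auto
  qed
  \<comment> \<open>Arcs of \<open>D1\<close> start strictly before \<open>m\<close> and arcs of
    \<open>D2\<close> end strictly after it, so an arc of \<open>D1\<close> and an arc of
    \<open>D2\<close> have different tails and different heads.\<close>
  have sep: "(u, w) \<notin> parcs D2 \<and> (w, v) \<notin> parcs D2" if "(u, v) \<in> parcs D1" for u v w
    using fwd1[OF that] mem1[OF that] neg'[of v] pos'[of u] mem2[of u w] mem2[of w v] fwd2[of w v]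
      pos'[of w] by auto
  have inE: "inj_on snd (E1 \<union> E2 \<union> (parcs D1 \<inter> {(s, m)}))"
  proof (rule inj_on_sndI)
    fix a c d assume "(a, d) \<in> E1 \<union> E2 \<union> (parcs D1 \<inter> {(s, m)})" "(c, d) \<in> E1 \<union> E2 \<union> (parcs D1 \<inter> {(s, m)})"
    then show "a = c"
      using inj_onD[OF d1(9), of "(a, d)" "(c, d)"] inj_onD[OF d2(9), of "(a, d)" "(c, d)"] pole1 sep sub1 sub2
      by fastforce
  qed
  have inF: "inj_on fst (F1 \<union> F2 \<union> (parcs D2 \<inter> {(m, t)}))"
  proof (rule inj_on_fstI)
    fix a b d assume "(a, b) \<in> F1 \<union> F2 \<union> (parcs D2 \<inter> {(m, t)})" "(a, d) \<in> F1 \<union> F2 \<union> (parcs D2 \<inter> {(m, t)})"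
    then show "b = d"
      using inj_onD[OF d1(10), of "(a, b)" "(a, d)"] inj_onD[OF d2(10), of "(a, b)" "(a, d)"] pole4 sep sub1 sub2
      by fastforce
  qed
  define X Y where "X = parcs D1 \<inter> {(s, m)}" and "Y = parcs D2 \<inter> {(m, t)}"
  have "(s, t) \<notin> parcs D1" "(s, t) \<notin> parcs D2"
    using mem1[of s t] mem2[of s t] st by auto
  moreover have "E1 \<union> F1 \<union> X = parcs D1" "E2 \<union> F2 \<union> Y = parcs D2"
    unfolding d1(5) d2(5) X_def Y_def by auto
  moreover have "E1 \<union> E2 \<union> X \<union> (F1 \<union> F2 \<union> Y) = (E1 \<union> F1 \<union> X) \<union> (E2 \<union> F2 \<union> Y)"
    by (simp add: Un_ac)
  ultimately have un: "E1 \<union> E2 \<union> X \<union> (F1 \<union> F2 \<union> Y) = parcs D1 \<union> parcs D2 - {(s, t)}" by simp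
  have "(s, m) \<notin> E1 \<union> F1" "(m, t) \<notin> E2 \<union> F2" unfolding d1(5) d2(5) by auto
  then have "X \<inter> F1 = {}" "E2 \<inter> Y = {}" by (auto simp: X_def Y_def)
  moreover have "parcs D1 \<inter> parcs D2 = {}" using sep by fast
  then have "P \<inter> Q = {}" "Q \<inter> P = {}" if "P \<subseteq> parcs D1" "Q \<subseteq> parcs D2" for P Q
    using Int_mono[OF that] by (simp_all add: Int_commute)
  note this[OF sub1(1) sub2(2)] this[OF sub1(2) sub2(1)] this[of X F2] this[of X Y] this[of E1 Y]
  moreover have "X \<subseteq> parcs D1" "Y \<subseteq> parcs D2" by (auto simp: X_def Y_def)
  ultimately have disj: "(E1 \<union> E2 \<union> X) \<inter> (F1 \<union> F2 \<union> Y) = {}"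
    using d1(6) d2(6) sub1 sub2 by (simp add: Int_Un_distrib Int_Un_distrib2)
  show ?thesis
  proof (rule two_pageI; (simp only: pair_pre_digraph.simps)?)
    show "f s \<le> f v" "f v \<le> f t" if "v \<in> pverts D1 \<union> pverts D2" for v by (rule le[OF that])+
    show "f u < f v" if "(u, v) \<in> parcs D1 \<union> parcs D2" for u v using that fwd1 fwd2 by blast
    show "v \<noteq> t" if "(u, v) \<in> E1 \<union> E2 \<union> (parcs D1 \<inter> {(s, m)})" for u v
      using that pole1 pole2 mem1[of u v] sub1 st by blast
    show "u \<noteq> s" if "(u, v) \<in> F1 \<union> F2 \<union> (parcs D2 \<inter> {(m, t)})" for u v
      using that pole3 mem2[of u v] sub2 st by blast
  qed (fact inj un[unfolded X_def Y_def] disj[unfolded X_def Y_def] ncE ncF inE inF)+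
qed

lemma sp_digraph_two_page:
  assumes "sp_digraph D s t"
  shows "\<exists>f E F. two_page D s t f E F"
  using assms
proof induction
  case (edge s t)
  \<comment> \<open>The only arc joins the poles, so both pages are empty.\<close>
  then have "two_page \<lparr>pverts = {s, t}, parcs = {(s, t)}\<rparr> s t (\<lambda>v. if v = s then 0 else 1) {} {}"
    by (auto simp: two_page_def noncrossing_def inj_on_def)
  then show ?case by blast
next
  case (parallel D1 s t D2)
  then obtain f1 E1 F1 f2 E2 F2 where "two_page D1 s t f1 E1 F1" "two_page D2 s t f2 E2 F2" by blast
  from two_page_parallel[OF parallel.hyps this] show ?case by blast
next
  case (series D1 s m D2 t)
  then obtain f1 E1 F1 f2 E2 F2 where "two_page D1 s m f1 E1 F1" "two_page D2 m t f2 E2 F2" by blast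
  from two_page_series[OF series.hyps this] show ?case by blast
qed


section \<open>Drawing a page\<close>

abbreviation diag :: "real \<Rightarrow> complex" where
  "diag x \<equiv> Complex x x"

definition arc_curve :: "('a \<Rightarrow> complex) \<Rightarrow> ('a \<times> 'a \<Rightarrow> complex) \<Rightarrow> 'a \<times> 'a \<Rightarrow> complex set" where
  "arc_curve p B e = closed_segment (p (fst e)) (B e) \<union> closed_segment (p (snd e)) (B e)"

definition arcs_disjoint :: "('a \<Rightarrow> complex) \<Rightarrow> ('a \<times> 'a \<Rightarrow> complex) \<Rightarrow> 'a \<times> 'a \<Rightarrow> 'a \<times> 'a \<Rightarrow> bool" where
  "arcs_disjoint p B e e' \<longleftrightarrow>
    arc_curve p B e \<inter> arc_curve p B e' \<subseteq> p ` ({fst e, snd e} \<inter> {fst e', snd e'})"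

text \<open>
  The arcs leaving a vertex are ranked by decreasing length, so that longer arcs are steeper; the
  rank over \<open>M\<close> is the inverse gradient.
\<close>

definition fan_bend :: "('a \<Rightarrow> real) \<Rightarrow> ('a \<times> 'a) set \<Rightarrow> real \<Rightarrow> 'a \<times> 'a \<Rightarrow> complex" where
  "fan_bend f E M e =
    Complex (f (fst e) + card {w. (fst e, w) \<in> E \<and> f (snd e) \<le> f w} / M * (f (snd e) - f (fst e))) (f (snd e))"

section \<open>Coordinates of points on the two segments of an arc\<close>

lemma oblique_segment:
  assumes "z \<in> closed_segment (diag a) (Complex (a + \<sigma> * (b - a)) (b))" "a < b"
  shows "a \<le> Im z" "Im z \<le> b" "Re z = a + \<sigma> * (Im z - a)"
proof -
  obtain t where t: "0 \<le> t" "t \<le> 1" "z = (1 - t) *\<^sub>R diag a + t *\<^sub>R Complex (a + \<sigma> * (b - a)) (b)"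
    using assms(1) by (auto simp: closed_segment_def)
  have im: "Im z = a + t * (b - a)" and re: "Re z = a + t * (\<sigma> * (b - a))"
    unfolding t(3) by (simp_all add: algebra_simps)
  have "0 \<le> t * (b - a)" using t assms(2) by simp
  moreover have "t * (b - a) \<le> 1 * (b - a)"
    using t assms(2) by (intro mult_right_mono) auto
  ultimately show "a \<le> Im z" "Im z \<le> b" using im by auto
  show "Re z = a + \<sigma> * (Im z - a)" using im re by simp
qed

lemma horizontal_segment:
  assumes "z \<in> closed_segment (diag b) (Complex x (b))" "x \<le> b"
  shows "Im z = b" "x \<le> Re z" "Re z \<le> b"
proof -
  obtain t where t: "0 \<le> t" "t \<le> 1" "z = (1 - t) *\<^sub>R diag b + t *\<^sub>R Complex x (b)"
    using assms(1) by (auto simp: closed_segment_def)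
  have im: "Im z = b" and re: "Re z = b + t * (x - b)"
    unfolding t(3) by (simp_all add: algebra_simps)
  have "t * (x - b) \<le> 0" using t assms(2) by (simp add: mult_nonneg_nonpos)
  moreover have "t * (b - x) \<le> 1 * (b - x)"
    using t assms(2) by (intro mult_right_mono) auto
  ultimately show "Im z = b" "x \<le> Re z" "Re z \<le> b" using im re by (auto simp: algebra_simps)
qed

text \<open>\<open>f\<close> is real-valued so that the second page can be treated by the same
  locale, with negated positions and reversed arcs. \<open>wide\<close> makes the rays so steep that
  an oblique segment shifts by less than one unit, the distance guaranteed by \<open>spread\<close>;
  hence the oblique segments of different tails lie in disjoint vertical strips.\<close>

locale page =
  fixes f :: "'a \<Rightarrow> real" and V :: "'a set" and E :: "('a \<times> 'a) set" and K :: nat and M :: real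
  assumes inj: "inj_on f V" and EV: "E \<subseteq> V \<times> V" and fin: "finite E"
    and spread: "\<lbrakk>u \<in> V; v \<in> V; f u < f v\<rbrakk> \<Longrightarrow> f u + 1 \<le> f v"
    and fwd: "(u, v) \<in> E \<Longrightarrow> f u < f v"
    and nc: "noncrossing f E" and in1: "inj_on snd E"
    and fan: "card {w. (u, w) \<in> E} \<le> K"
    and wide: "(u, v) \<in> E \<Longrightarrow> K * (f v - f u) < M" and M: "0 < M"
begin

abbreviation p :: "'a \<Rightarrow> complex" where "p v \<equiv> diag (f v)"

abbreviation B :: "'a \<times> 'a \<Rightarrow> complex" where "B \<equiv> fan_bend f E M"

section \<open>Ranks in a fan and the shape of the curves\<close>

definition rank :: "'a \<Rightarrow> 'a \<Rightarrow> nat" where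
  "rank u v = card {w. (u, w) \<in> E \<and> f v \<le> f w}"

lemma gap: "(u, v) \<in> E \<Longrightarrow> f u + 1 \<le> f v"
  using spread fwd EV by auto

lemma B_eq: "B (u, v) = Complex (f u + rank u v / M * (f v - f u)) (f v)"
  by (simp add: fan_bend_def rank_def)

lemma finite_out: "finite {w. (u, w) \<in> E \<and> P w}"
  by (rule finite_subset[of _ "snd ` E"]) (use fin in \<open>force+\<close>)

lemma rank_bounds:
  assumes "(u, v) \<in> E"
  shows "1 \<le> rank u v" "rank u v \<le> K"
proof -
  have "rank u v \<noteq> 0" using assms finite_out[of u] by (auto simp: rank_def)
  then show "1 \<le> rank u v" by simp
  have "rank u v \<le> card {w. (u, w) \<in> E}"
    unfolding rank_def using finite_out[of u "\<lambda>_. True"] by (intro card_mono) auto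
  with fan[of u] show "rank u v \<le> K" by simp
qed

text \<open>The nearer head is counted in its own rank but not in that of the farther one.\<close>

lemma rank_less:
  assumes "(u, v) \<in> E" "(u, w) \<in> E" "f v < f w"
  shows "rank u w < rank u v"
proof -
  have "{x. (u, x) \<in> E \<and> f w \<le> f x} \<subset> {x. (u, x) \<in> E \<and> f v \<le> f x}"
  proof (rule psubsetI)
    show "{x. (u, x) \<in> E \<and> f w \<le> f x} \<subseteq> {x. (u, x) \<in> E \<and> f v \<le> f x}" using assms(3) by auto
    have "v \<in> {x. (u, x) \<in> E \<and> f v \<le> f x} - {x. (u, x) \<in> E \<and> f w \<le> f x}" using assms by simp
    then show "{x. (u, x) \<in> E \<and> f w \<le> f x} \<noteq> {x. (u, x) \<in> E \<and> f v \<le> f x}" by blast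
  qed
  then show ?thesis unfolding rank_def by (rule psubset_card_mono[OF finite_out])
qed

lemma shift_less_1:
  assumes "(u, v) \<in> E"
  shows "rank u v / M * (f v - f u) < 1"
proof -
  have "rank u v * (f v - f u) \<le> K * (f v - f u)"
    using rank_bounds[OF assms] fwd[OF assms] by (intro mult_right_mono) auto
  also have "\<dots> < M" by (rule wide[OF assms])
  finally show ?thesis using M by (simp add: field_simps)
qed

text \<open>The first alternative is the oblique segment, the second the horizontal one. On the
  oblique segment the shift grows with the height and is still below one at the bend, which confines
  it to the unit strip to the right of its tail.\<close>

lemma curve_cases:
  assumes e: "(u, v) \<in> E" and z: "z \<in> arc_curve p B (u, v)"
  shows "f u \<le> Im z \<and> Im z \<le> f v \<and> f u \<le> Re z \<and> Re z < f u + 1 \<and> Re z = f u + rank u v / M * (Im z - f u) \<or>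
    Im z = f v \<and> f u + rank u v / M * (f v - f u) \<le> Re z \<and> Re z \<le> f v"
proof -
  let ?\<sigma> = "rank u v / M"
  have \<sigma>: "?\<sigma> \<ge> 0" using M by simp
  have uv: "f u < f v" by (rule fwd[OF e])
  have "f u + 1 \<le> f v" by (rule gap[OF e])
  with shift_less_1[OF e] have x: "f u + ?\<sigma> * (f v - f u) \<le> f v" by linarith
  from z consider "z \<in> closed_segment (p u) (B (u, v))" | "z \<in> closed_segment (p v) (B (u, v))"
    by (auto simp: arc_curve_def)
  then show ?thesis
  proof cases
    case 1
    note s = oblique_segment[of z "f u" ?\<sigma> "f v", OF 1[unfolded B_eq] uv]
    have "0 \<le> ?\<sigma> * (Im z - f u)" using \<sigma> s(1) by (intro mult_nonneg_nonneg) auto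
    moreover have "?\<sigma> * (Im z - f u) \<le> ?\<sigma> * (f v - f u)" using \<sigma> s(2) by (intro mult_left_mono) auto
    ultimately show ?thesis using s shift_less_1[OF e] by linarith
  next
    case 2
    show ?thesis using horizontal_segment[OF 2[unfolded B_eq] x] by simp
  qed
qed

text \<open>An arc has length at least one but shift less than one, so its inverse gradient is below
  one and the oblique segment rises off the diagonal; the horizontal segment runs to the left of the
  head. This later keeps the two pages on opposite sides of the diagonal.\<close>

lemma curve_above:
  assumes e: "(u, v) \<in> E" and z: "z \<in> arc_curve p B (u, v)"
  shows "Re z \<le> Im z" "Re z = Im z \<Longrightarrow> z = p u \<or> z = p v"
proof -
  let ?\<sigma> = "rank u v / M"
  have "f v - f u \<ge> 1" using gap[OF e] by linarith
  moreover have \<sigma>: "?\<sigma> \<ge> 0" using M by simp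
  ultimately have "?\<sigma> * 1 \<le> ?\<sigma> * (f v - f u)" by (intro mult_left_mono)
  with shift_less_1[OF e] have \<sigma>1: "?\<sigma> < 1" by simp
  have "Re z \<le> Im z \<and> (Re z = Im z \<longrightarrow> z = p u \<or> z = p v)"
    using curve_cases[OF e z]
  proof
    assume a: "f u \<le> Im z \<and> Im z \<le> f v \<and> f u \<le> Re z \<and> Re z < f u + 1 \<and> Re z = f u + ?\<sigma> * (Im z - f u)"
    have "?\<sigma> * (Im z - f u) \<le> 1 * (Im z - f u)" using a \<sigma>1 by (intro mult_right_mono) auto
    moreover have "?\<sigma> * (Im z - f u) < 1 * (Im z - f u)" if "f u < Im z"
      using that \<sigma>1 by (intro mult_strict_right_mono) auto
    ultimately show ?thesis using a by (cases "f u < Im z") (auto simp: complex_eq_iff)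
  next
    assume "Im z = f v \<and> f u + ?\<sigma> * (f v - f u) \<le> Re z \<and> Re z \<le> f v"
    then show ?thesis by (auto simp: complex_eq_iff)
  qed
  then show "Re z \<le> Im z" "Re z = Im z \<Longrightarrow> z = p u \<or> z = p v" by auto
qed

lemma segments_meet:
  assumes e: "(u, v) \<in> E"
  shows "closed_segment (p u) (B (u, v)) \<inter> closed_segment (p v) (B (u, v)) = {B (u, v)}"
    "B (u, v) \<noteq> p u" "B (u, v) \<noteq> p v"
proof -
  let ?\<sigma> = "rank u v / M"
  have uv: "f u < f v" by (rule fwd[OF e])
  have "f u + 1 \<le> f v" by (rule gap[OF e])
  with shift_less_1[OF e] have x: "f u + ?\<sigma> * (f v - f u) < f v" by linarith
  show "B (u, v) \<noteq> p u" "B (u, v) \<noteq> p v" using uv x by (auto simp: B_eq)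
  have "z = B (u, v)" if z: "z \<in> closed_segment (p u) (B (u, v))" "z \<in> closed_segment (p v) (B (u, v))" for z
    using oblique_segment[of z "f u" ?\<sigma> "f v", OF z(1)[unfolded B_eq] uv]
      horizontal_segment[OF z(2)[unfolded B_eq] less_imp_le[OF x]]
    by (simp add: B_eq complex_eq_iff)
  then show "closed_segment (p u) (B (u, v)) \<inter> closed_segment (p v) (B (u, v)) = {B (u, v)}"
    by auto
qed

text \<open>The oblique direction depends on the rank alone and not on the tail, so all fans share
  the same \<open>K\<close> directions.\<close>

lemma segment_directions:
  assumes e: "(u, v) \<in> E"
  shows "\<exists>k r. k \<in> {1..K} \<and> B (u, v) - p u = of_real r * Complex (k / M) 1"
    "\<exists>r. B (u, v) - p v = of_real r"
proof -
  have "B (u, v) - p u = of_real (f v - f u) * Complex (rank u v / M) 1"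
    by (simp add: B_eq complex_eq_iff)
  then show "\<exists>k r. k \<in> {1..K} \<and> B (u, v) - p u = of_real r * Complex (k / M) 1"
    using rank_bounds[OF e] by (metis atLeastAtMost_iff)
  have "B (u, v) - p v = of_real (Re (B (u, v) - p v))"
    by (simp add: B_eq complex_eq_iff)
  then show "\<exists>r. B (u, v) - p v = of_real r" ..
qed

text \<open>\<open>less\<close> orders the two arcs lexicographically by tail and head; by
  injectivity of \<open>f\<close> and symmetry this covers every pair of distinct arcs.\<close>

lemma disjoint_aux:
  assumes e: "(a, b) \<in> E" "(c, d) \<in> E" and less: "f a < f c \<or> a = c \<and> f b < f d"
  shows "arcs_disjoint p B (a, b) (c, d)"
  unfolding arcs_disjoint_def
proof
  fix z assume "z \<in> arc_curve p B (a, b) \<inter> arc_curve p B (c, d)"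
  then have z: "z \<in> arc_curve p B (a, b)" "z \<in> arc_curve p B (c, d)" by auto
  note c1 = curve_cases[OF e(1) z(1)] and c2 = curve_cases[OF e(2) z(2)]
  have V: "a \<in> V" "b \<in> V" "c \<in> V" "d \<in> V" using e EV by auto
  from less have "z = p a \<and> a = c \<or> z = p b \<and> b = c"
  proof
    assume less: "a = c \<and> f b < f d"
    have "rank a d / M < rank a b / M" 
      using rank_less[of a b d] e less M by (simp add: divide_strict_right_mono)
    \<comment> \<open>At a common tail the longer arc has the smaller inverse gradient. Above the
      tail its ray is therefore to the left of the ray of the shorter arc, and also to the left of
      the horizontal segment of the shorter arc, which runs from the bend to the right.\<close>
    then have lt: "rank a d / M * y < rank a b / M * y" if "y > 0" for y
      using that by (intro mult_strict_right_mono) auto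
    have "Im z = f a"
    proof (rule ccontr)
      assume "Im z \<noteq> f a"
      then show False
        using c1 c2 lt[of "Im z - f a"] less fwd[OF e(1)] by auto
    qed
    then have "z = p a" using c1 fwd[OF e(1)] by (auto simp: complex_eq_iff)
    with less show ?thesis by simp
  next
    assume less: "f a < f c"
    then have less': "f a + 1 \<le> f c" using spread V by simp
    show ?thesis
    proof (cases "f b \<le> f c")
      case True
      \<comment> \<open>The first curve ends at height \<open>f b\<close> and the second begins at
        height \<open>f c\<close>, so they can touch only if these heights agree.\<close>
      have "Im z \<le> f b" "f c \<le> Im z" using c1 c2 fwd[OF e(1)] fwd[OF e(2)] by auto
      with True have eq: "f b = f c" "Im z = f b" by linarith+
      then have "b = c" using inj V by (auto dest: inj_onD)
      moreover have "z = p c" using eq c2 fwd[OF e(2)] by (auto simp: complex_eq_iff)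
      ultimately show ?thesis by simp
    next
      case False
      \<comment> \<open>The heads differ because a vertex has at most one incoming arc on the page.
        As the arcs do not cross, \<open>(c, d)\<close> is then nested inside
        \<open>(a, b)\<close>.\<close>
      have "f b \<noteq> f d"
      proof
        assume "f b = f d"
        then have "b = d" using inj V by (auto dest: inj_onD)
        then have "a = c" using inj_onD[OF in1, of "(a, b)" "(c, d)"] e by simp
        with less show False by simp
      qed
      moreover have "\<not> f b < f d" using nc e less False unfolding noncrossing_def by force
      ultimately have "f d < f b" by simp
      \<comment> \<open>The inner curve never goes to the left of \<open>f c\<close>. Below height
        \<open>f b\<close> the outer curve consists of its oblique segment only, which stays to the
        left of \<open>f a + 1\<close>.\<close>
      have "f c \<le> Re z" using c2
      proof
        have "0 \<le> rank c d / M * (f d - f c)" 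
          using M fwd[OF e(2)] by (intro mult_nonneg_nonneg) auto
        moreover assume "Im z = f d \<and> f c + rank c d / M * (f d - f c) \<le> Re z \<and> Re z \<le> f d"
        ultimately show ?thesis by linarith
      qed auto
      moreover have "Im z < f b" using c2 \<open>f d < f b\<close> by auto
      ultimately show ?thesis using c1 less' by auto
    qed
  qed
  then show "z \<in> p ` ({fst (a, b), snd (a, b)} \<inter> {fst (c, d), snd (c, d)})" by auto
qed

lemma arcs_disjoint:
  assumes "e \<in> E" "e' \<in> E" "e \<noteq> e'"
  shows "arcs_disjoint p B e e'"
proof -
  obtain a b c d where e: "e = (a, b)" "e' = (c, d)" by fastforce
  have V: "a \<in> V" "b \<in> V" "c \<in> V" "d \<in> V" using e EV assms by auto
  have sym: "arcs_disjoint p B (c, d) (a, b) \<Longrightarrow> arcs_disjoint p B (a, b) (c, d)"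
    unfolding arcs_disjoint_def by (simp add: Int_commute)
  have "f a < f c \<or> f c < f a \<or> a = c \<and> (f b < f d \<or> f d < f b)"
    using assms(3) e V inj by (metis inj_onD linorder_cases)
  then show ?thesis unfolding e
    using disjoint_aux[of a b c d] disjoint_aux[of c d a b] sym assms e by blast
qed

end

section \<open>Slopes of segments, and drawings assembled from arcs\<close>

lemma line_slope_cong:
  assumes "q - p = of_real r * d" "q \<noteq> p"
  shows "line_slope (affine hull {p, q}) = line_slope (affine hull {0, d})"
proof -
  have r: "r \<noteq> 0" using assms by auto
  have "range (\<lambda>u. u *\<^sub>R (q - p)) = (\<lambda>v. v *\<^sub>R d) ` range (\<lambda>u. u * r)"
    by (simp add: assms(1) image_image scaleR_conv_of_real mult.assoc)
  also have "range (\<lambda>u. u * r) = UNIV"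
    using r by (intro surjI[where f = "\<lambda>v. v / r"]) simp
  finally have dir: "range (\<lambda>u. u *\<^sub>R (q - p)) = range (\<lambda>v. v *\<^sub>R d)" .
  have "affine hull {p, q} = (+) p ` range (\<lambda>u. u *\<^sub>R (q - p))"
    unfolding affine_hull_2_alt image_image ..
  also have "\<dots> = (+) p ` (affine hull {0, d})"
    unfolding dir affine_hull_2_alt by simp
  finally have "affine hull {p, q} = (+) p ` (affine hull {0, d})" .
  \<comment> \<open>\<open>line_slope\<close> tests an angle up to a translation \<open>a\<close>,
    which absorbs the shift by \<open>p\<close>; so both lines have the same candidate
    angles.\<close>
  moreover have "(\<exists>a. (+) p ` L = (\<lambda>x. a + c * x) ` \<real>) \<longleftrightarrow> (\<exists>a. L = (\<lambda>x. a + c * x) ` \<real>)"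
    for L c
  proof
    assume "\<exists>a. (+) p ` L = (\<lambda>x. a + c * x) ` \<real>"
    then obtain a where a: "(+) p ` L = (\<lambda>x. a + c * x) ` \<real>" ..
    have "L = (\<lambda>z. z - p) ` (+) p ` L" by (simp add: image_image)
    also have "\<dots> = (\<lambda>x. (a - p) + c * x) ` \<real>" unfolding a by (simp add: image_image algebra_simps)
    finally show "\<exists>a. L = (\<lambda>x. a + c * x) ` \<real>" ..
  next
    assume "\<exists>a. L = (\<lambda>x. a + c * x) ` \<real>"
    then obtain a where a: "L = (\<lambda>x. a + c * x) ` \<real>" ..
    have "(+) p ` L = (\<lambda>x. (p + a) + c * x) ` \<real>" unfolding a by (simp add: image_image add.assoc)
    then show "\<exists>a. (+) p ` L = (\<lambda>x. a + c * x) ` \<real>" ..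
  qed
  ultimately show ?thesis by (simp add: line_slope_def)
qed

lemma mem_closed_segment_minus:
  fixes a b z :: complex
  shows "z \<in> closed_segment (- a) (- b) \<longleftrightarrow> - z \<in> closed_segment a b"
proof -
  have "closed_segment (- a) (- b) = uminus ` closed_segment a b"
    by (rule closed_segment_linear_image) (simp add: linear_uminus)
  then show ?thesis by force
qed

definition two_element_edges :: "('a \<times> 'a) set \<Rightarrow> 'a set set" where
  "two_element_edges A = (\<lambda>e. {fst e, snd e}) ` A"

text \<open>This is the interface between arcs and the definition of a drawing: the geometry is
  checked on the curves of arcs, and every edge receives a bend. Each segment is parallel to some
  direction in \<open>X\<close>, so the size of \<open>X\<close> bounds the number of
  slopes.\<close>

lemma drawing_of_arcs:
  fixes pos :: "'a \<Rightarrow> complex" and B :: "'a \<times> 'a \<Rightarrow> complex"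
  assumes AV: "A \<subseteq> V \<times> V" and inj: "inj_on pos V"
    and injA: "inj_on (\<lambda>e. {fst e, snd e}) A"
    and bend: "\<And>u v. (u, v) \<in> A \<Longrightarrow> B (u, v) \<noteq> pos u \<and> B (u, v) \<noteq> pos v \<and>
      closed_segment (pos u) (B (u, v)) \<inter> closed_segment (pos v) (B (u, v)) = {B (u, v)}"
    and vert: "\<And>e w. e \<in> A \<Longrightarrow> w \<in> V \<Longrightarrow> pos w \<in> arc_curve pos B e \<Longrightarrow> w \<in> {fst e, snd e}"
    and disj: "\<And>e e'. e \<in> A \<Longrightarrow> e' \<in> A \<Longrightarrow> e \<noteq> e' \<Longrightarrow> arcs_disjoint pos B e e'"
    and slope: "\<And>u v w. (u, v) \<in> A \<Longrightarrow> w \<in> {u, v} \<Longrightarrow> \<exists>r. \<exists>d \<in> X. B (u, v) - pos w = of_real r * d"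
    and X: "finite X"
  shows "\<exists>bend. one_bend_planar_drawing \<lparr>uverts = V, uedges = two_element_edges A\<rparr> pos bend \<and>
    finite (drawing_slopes \<lparr>uverts = V, uedges = two_element_edges A\<rparr> pos bend) \<and>
    card (drawing_slopes \<lparr>uverts = V, uedges = two_element_edges A\<rparr> pos bend) \<le> card X"
proof -
  \<comment> \<open>By \<open>injA\<close> an edge comes from a single arc, so the bend of an arc
    can serve as the bend of its edge.\<close>
  define arc where "arc = inv_into A (\<lambda>e. {fst e, snd e})"
  define bd where "bd x = Some (B (arc x))" for x
  let ?G = "\<lparr>uverts = V, uedges = two_element_edges A\<rparr>"
  have arc: "arc {fst e, snd e} = e" if "e \<in> A" for e
    using inv_into_f_f[OF injA that] by (simp add: arc_def)
  have segs: "edge_segments pos bd {fst e, snd e} =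
      {closed_segment (pos (fst e)) (B e), closed_segment (pos (snd e)) (B e)}" if "e \<in> A" for e
    by (simp add: edge_segments_def bd_def arc[OF that])
  have curve: "edge_curve pos bd {fst e, snd e} = arc_curve pos B e" if "e \<in> A" for e
    by (simp add: edge_curve_def segs[OF that] arc_curve_def)
  have "one_bend_planar_drawing ?G pos bd"
    unfolding one_bend_planar_drawing_def
  proof (intro conjI ballI allI impI; (simp only: ugraph.simps two_element_edges_def)?)
    show "inj_on pos V" by (rule inj)
    fix x assume "x \<in> (\<lambda>e. {fst e, snd e}) ` A"
    then obtain e where e: "e \<in> A" and x: "x = {fst e, snd e}" by auto
    have e': "(fst e, snd e) \<in> A" using e by simp
    note b = bend[OF e', simplified]
    show "b \<notin> pos ` x" if "bd x = Some b" for b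
      using that b by (auto simp: x bd_def arc[OF e])
    show "closed_segment (pos u) b \<inter> closed_segment (pos v) b = {b}"
      if "bd x = Some b" "u \<in> x" "v \<in> x" "u \<noteq> v" for b u v
      using that b by (auto simp: x bd_def arc[OF e] Int_commute)
    show "v \<in> x" if "v \<in> V" "pos v \<in> edge_curve pos bd x" for v
      using vert[OF e, of v] that by (simp add: x curve[OF e])
    fix y assume "y \<in> (\<lambda>e. {fst e, snd e}) ` A" "x \<noteq> y"
    then obtain e2 where e2: "e2 \<in> A" and y: "y = {fst e2, snd e2}" and "e \<noteq> e2" using x by auto
    then show "edge_curve pos bd x \<inter> edge_curve pos bd y \<subseteq> pos ` (x \<inter> y)"
      using disj[OF e e2] by (simp add: x y curve[OF e] curve[OF e2] arcs_disjoint_def)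
  qed
  moreover have sub: "drawing_slopes ?G pos bd \<subseteq> (\<lambda>d. line_slope (affine hull {0, d})) ` X"
  proof
    fix \<theta> assume "\<theta> \<in> drawing_slopes ?G pos bd"
    then obtain e S where e: "e \<in> A" and S: "S \<in> edge_segments pos bd {fst e, snd e}"
      and \<theta>: "\<theta> = line_slope (affine hull S)"
      by (auto simp: drawing_slopes_def two_element_edges_def)
    from S obtain w where w: "w \<in> {fst e, snd e}" and S: "S = closed_segment (pos w) (B e)"
      by (auto simp: segs[OF e])
    have e': "(fst e, snd e) \<in> A" using e by simp
    obtain r d where d: "d \<in> X" "B e - pos w = of_real r * d"
      using slope[OF e' w] by auto
    have "B e \<noteq> pos w" using bend[OF e'] w by auto
    with d show "\<theta> \<in> (\<lambda>d. line_slope (affine hull {0, d})) ` X"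
      by (auto simp: \<theta> S line_slope_cong)
  qed
  moreover have "finite (drawing_slopes ?G pos bd)"
    by (rule finite_subset[OF sub]) (simp add: X)
  moreover have "card (drawing_slopes ?G pos bd) \<le> card X"
    using card_mono[OF _ sub] card_image_le[OF X, of "\<lambda>d. line_slope (affine hull {0, d})"] X
    by (meson finite_imageI order_trans)
  ultimately show ?thesis by blast
qed

lemma book_embedding_drawing:
  fixes f :: "'a \<Rightarrow> int"
  assumes V: "finite V" "inj_on f V" and A: "E \<union> F \<subseteq> V \<times> V" and EF: "E \<inter> F = {}"
    and fwd: "\<And>u v. (u, v) \<in> E \<union> F \<Longrightarrow> f u < f v"
    and nc: "noncrossing f E" "noncrossing f F"
    and inE: "inj_on snd E" and inF: "inj_on fst F"
    and fanE: "\<And>u. card {v. (u, v) \<in> E} \<le> K" and fanF: "\<And>v. card {u. (u, v) \<in> F} \<le> K"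
  shows "drawable_with_slopes \<lparr>uverts = V, uedges = two_element_edges (E \<union> F)\<rparr> (Suc K)"
proof -
  define g where "g v = real_of_int (f v)" for v
  \<comment> \<open>The sum is at least every single arc length; the summand 1 makes the bound
    strict and \<open>M\<close> positive even without arcs or with \<open>K = 0\<close>.\<close>
  define M where "M = K * (\<Sum>e \<in> E \<union> F. g (snd e) - g (fst e)) + 1"
  have finA: "finite (E \<union> F)" by (rule finite_subset[OF A]) (simp add: V)
  have gf: "g u < g v \<longleftrightarrow> f u < f v" for u v by (simp add: g_def)
  have gfwd: "g u < g v" if "(u, v) \<in> E \<union> F" for u v using fwd[OF that] by (simp add: gf)
  have len: "0 \<le> g (snd e) - g (fst e)" if "e \<in> E \<union> F" for e
    using gfwd[of "fst e" "snd e"] that by simp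
  have wide: "K * (g v - g u) < M" if "(u, v) \<in> E \<union> F" for u v
  proof -
    have "g (snd (u, v)) - g (fst (u, v)) \<le> (\<Sum>e \<in> E \<union> F. g (snd e) - g (fst e))"
      by (rule member_le_sum) (use that len finA in auto)
    then have "K * (g v - g u) \<le> K * (\<Sum>e \<in> E \<union> F. g (snd e) - g (fst e))"
      by (intro mult_left_mono) auto
    then show ?thesis by (simp add: M_def)
  qed
  have "0 \<le> (\<Sum>e \<in> E \<union> F. g (snd e) - g (fst e))" by (rule sum_nonneg[OF len])
  then have M: "0 < M" by (simp add: M_def add_nonneg_pos)
  have injg: "inj_on g V" using V(2) by (auto simp: g_def inj_on_def)
  \<comment> \<open>Positions are integers, so distinct ones are at least one apart.\<close>
  have sp: "g u + 1 \<le> g v" if "g u < g v" for u v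
    using that by (simp add: g_def)
  interpret up: page g V E K M
  proof
    show "E \<subseteq> V \<times> V" "finite E" using A finA by auto
    show "noncrossing g E" using nc(1) unfolding noncrossing_def gf .
  qed (use injg sp gfwd inE fanE wide M in auto)
  \<comment> \<open>Negating positions reflects the plane in the origin and reverses the arcs: at
    most one outgoing arc per vertex in \<open>F\<close> becomes at most one incoming arc in its
    converse.\<close>
  define h where "h v = - g v" for v
  interpret dn: page h V "F\<inverse>" K M
  proof
    show "inj_on h V" using injg by (auto simp: h_def inj_on_def)
    show "F\<inverse> \<subseteq> V \<times> V" "finite (F\<inverse>)" using A finA by auto
    show "h u + 1 \<le> h v" if "h u < h v" for u v using that sp[of v u] by (simp add: h_def)
    show "h u < h v" if "(u, v) \<in> F\<inverse>" for u v using that gfwd[of v u] by (simp add: h_def)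
    show "noncrossing h (F\<inverse>)" using nc(2) unfolding noncrossing_def h_def by (auto simp: gf)
    show "inj_on snd (F\<inverse>)" using inF by (force simp: inj_on_def)
    show "card {w. (u, w) \<in> F\<inverse>} \<le> K" for u using fanF[of u] by simp
    show "K * (h v - h u) < M" if "(u, v) \<in> F\<inverse>" for u v
      using wide[of v u] that by (simp add: h_def)
  qed (rule M)
  define pos where "pos v = diag (g v)" for v
  define B where "B e = (if e \<in> E then up.B e else - dn.B (snd e, fst e))" for e
  have hp: "diag (h v) = - pos v" for v by (simp add: h_def pos_def complex_eq_iff)
  have BE: "B e = up.B e" if "e \<in> E" for e using that by (simp add: B_def)
  have BF: "B (u, v) = - dn.B (v, u)" if "(u, v) \<in> F" for u v
    using that EF by (auto simp: B_def)
  have cE: "arc_curve pos B e = arc_curve up.p up.B e" if "e \<in> E" for e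
    by (simp add: arc_curve_def BE[OF that] pos_def)
  have cF: "z \<in> arc_curve pos B (u, v) \<longleftrightarrow> - z \<in> arc_curve dn.p dn.B (v, u)" if "(u, v) \<in> F" for u v z
    by (auto simp: arc_curve_def BF[OF that] hp mem_closed_segment_minus[of z "- pos _", simplified])
  have diagE: "Re z \<le> Im z \<and> (Re z = Im z \<longrightarrow> z = pos u \<or> z = pos v)"
    if "(u, v) \<in> E" "z \<in> arc_curve pos B (u, v)" for u v z
    using up.curve_above[OF that(1)] that cE[OF that(1)] by (auto simp: pos_def)
  have diagF: "Im z \<le> Re z \<and> (Re z = Im z \<longrightarrow> z = pos u \<or> z = pos v)"
    if "(u, v) \<in> F" "z \<in> arc_curve pos B (u, v)" for u v z
    using dn.curve_above[of v u "- z"] that cF[OF that(1)] by (auto simp: hp)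
  have diag: "z \<in> pos ` {fst e, snd e}"
    if "e \<in> E \<union> F" "z \<in> arc_curve pos B e" "Re z = Im z" for e z
    using that diagE[of "fst e" "snd e" z] diagF[of "fst e" "snd e" z] by auto
  have injpos: "inj_on pos V" using injg by (auto simp: pos_def inj_on_def)
  \<comment> \<open>The curve from \<open>E\<close> is nowhere below the diagonal and the curve from
    \<open>F\<close> nowhere above it; on the diagonal each has only its end-vertices.\<close>
  have mixed: "arcs_disjoint pos B e e'" if e: "e \<in> E" "e' \<in> F" for e e'
    unfolding arcs_disjoint_def
  proof
    fix z assume z: "z \<in> arc_curve pos B e \<inter> arc_curve pos B e'"
    then have "Re z = Im z"
      using diagE[of "fst e" "snd e" z] diagF[of "fst e'" "snd e'" z] e by auto
    with z e diag[of e z] diag[of e' z] have "z \<in> pos ` {fst e, snd e}" "z \<in> pos ` {fst e', snd e'}" by auto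
    moreover have "{fst e, snd e} \<subseteq> V" "{fst e', snd e'} \<subseteq> V" using e A by auto
    ultimately show "z \<in> pos ` ({fst e, snd e} \<inter> {fst e', snd e'})"
      by (simp only: inj_on_image_Int[OF injpos] Int_iff)
  qed
  have disj: "arcs_disjoint pos B e e'" if e: "e \<in> E \<union> F" "e' \<in> E \<union> F" "e \<noteq> e'" for e e'
  proof -
    consider "e \<in> E" "e' \<in> E" | "e \<in> E" "e' \<in> F" | "e \<in> F" "e' \<in> E" | "e \<in> F" "e' \<in> F"
      using e by auto
    then show ?thesis
    proof cases
      case 1
      with up.arcs_disjoint[OF 1 e(3)] show ?thesis by (simp add: arcs_disjoint_def cE pos_def)
    next
      case 2
      then show ?thesis by (rule mixed)
    next
      case 3
      with mixed[of e' e] show ?thesis by (simp add: arcs_disjoint_def Int_commute)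
    next
      case 4
      obtain a b c d where ab: "e = (a, b)" "e' = (c, d)" by fastforce
      have F: "(a, b) \<in> F" "(c, d) \<in> F" using 4 ab by auto
      have "arcs_disjoint dn.p dn.B (b, a) (d, c)"
        using e(3) F unfolding ab by (intro dn.arcs_disjoint) auto
      then have "- z \<in> dn.p ` ({a, b} \<inter> {c, d})"
        if "z \<in> arc_curve pos B e" "z \<in> arc_curve pos B e'" for z
        using that unfolding ab cF[OF F(1)] cF[OF F(2)] arcs_disjoint_def
        by (auto simp: insert_commute)
      then show ?thesis unfolding arcs_disjoint_def ab hp by fastforce
    qed
  qed
  \<comment> \<open>The element 1 is the horizontal direction. The \<open>K\<close> oblique ones
    serve both pages, because a point reflection preserves the slope of a line.\<close>
  define X where "X = insert 1 ((\<lambda>k. Complex (real k / M) 1) ` {1..K})"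
  have "\<exists>bend. one_bend_planar_drawing \<lparr>uverts = V, uedges = two_element_edges (E \<union> F)\<rparr> pos bend \<and>
    finite (drawing_slopes \<lparr>uverts = V, uedges = two_element_edges (E \<union> F)\<rparr> pos bend) \<and>
    card (drawing_slopes \<lparr>uverts = V, uedges = two_element_edges (E \<union> F)\<rparr> pos bend) \<le> card X"
  proof (rule drawing_of_arcs)
    show "E \<union> F \<subseteq> V \<times> V" by (rule A)
    show "inj_on pos V" by (rule injpos)
    show "inj_on (\<lambda>e. {fst e, snd e}) (E \<union> F)"
    proof (rule inj_onI)
      fix e e' assume e: "e \<in> E \<union> F" "e' \<in> E \<union> F" "{fst e, snd e} = {fst e', snd e'}"
      then show "e = e'"
        using fwd[of "fst e" "snd e"] fwd[of "fst e'" "snd e'"]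
        by (auto simp: doubleton_eq_iff prod_eq_iff)
    qed
    show "arcs_disjoint pos B e e'" if "e \<in> E \<union> F" "e' \<in> E \<union> F" "e \<noteq> e'" for e e'
      by (rule disj[OF that])
    show "w \<in> {fst e, snd e}" if "e \<in> E \<union> F" "w \<in> V" "pos w \<in> arc_curve pos B e" for e w
    proof -
      have "pos w \<in> pos ` {fst e, snd e}" using diag[OF that(1,3)] by (simp add: pos_def)
      moreover have "{fst e, snd e} \<subseteq> V" using that(1) A by auto
      ultimately show ?thesis using inj_on_image_mem_iff[OF injpos that(2)] by blast
    qed
    show "B (u, v) \<noteq> pos u \<and> B (u, v) \<noteq> pos v \<and>
      closed_segment (pos u) (B (u, v)) \<inter> closed_segment (pos v) (B (u, v)) = {B (u, v)}"
      if "(u, v) \<in> E \<union> F" for u v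
    proof (cases "(u, v) \<in> E")
      case True
      then show ?thesis using up.segments_meet[OF True] by (simp add: BE pos_def)
    next
      case False
      with that have F: "(u, v) \<in> F" "(v, u) \<in> F\<inverse>" by auto
      note m = dn.segments_meet[OF F(2), unfolded hp]
      have "z \<in> closed_segment (pos u) (B (u, v)) \<inter> closed_segment (pos v) (B (u, v)) \<longleftrightarrow> z = B (u, v)" for z
      proof -
        have "z \<in> closed_segment (pos u) (B (u, v)) \<inter> closed_segment (pos v) (B (u, v)) \<longleftrightarrow>
          - z \<in> closed_segment (- pos v) (dn.B (v, u)) \<inter> closed_segment (- pos u) (dn.B (v, u))"
          using mem_closed_segment_minus[of z "- pos u" "dn.B (v, u)"]
            mem_closed_segment_minus[of z "- pos v" "dn.B (v, u)"] by (auto simp: BF[OF F(1)])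
        then show ?thesis unfolding m(1) BF[OF F(1)] singleton_iff by (metis minus_minus)
      qed
      moreover have "B (u, v) \<noteq> pos u" "B (u, v) \<noteq> pos v"
        using m(2,3) unfolding BF[OF F(1)] by (metis minus_minus)+
      ultimately show ?thesis by blast
    qed
    show "\<exists>r. \<exists>d \<in> X. B (u, v) - pos w = of_real r * d"
      if e: "(u, v) \<in> E \<union> F" and w: "w \<in> {u, v}" for u v w
    proof -
      have one: "\<exists>r. \<exists>d \<in> X. y = of_real r * d" if "\<exists>r. y = of_real r" for y :: complex
        using that by (auto simp: X_def)
      have obl: "\<exists>r. \<exists>d \<in> X. y = of_real r * d"
        if "\<exists>k r. k \<in> {1..K} \<and> y = of_real r * Complex (real k / M) 1" for y :: complex
        using that unfolding X_def by blast
      \<comment> \<open>The sign introduced by the reflection is absorbed into the real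
        factor.\<close>
      have neg: "\<exists>r. \<exists>d \<in> X. y = of_real r * d" if "\<exists>r. \<exists>d \<in> X. - y = of_real r * d" for y
        using that by (metis minus_minus mult_minus_left of_real_minus)
      show ?thesis
      proof (cases "(u, v) \<in> E")
        case True
        show ?thesis
          using one[OF up.segment_directions(2)[OF True]] obl[OF up.segment_directions(1)[OF True]] w
          by (auto simp: BE[OF True] pos_def)
      next
        case False
        with e have F: "(u, v) \<in> F" "(v, u) \<in> F\<inverse>" by auto
        have "- (B (u, v) - pos w) = dn.B (v, u) - dn.p w" for w by (simp add: BF[OF F(1)] hp)
        then show ?thesis
          using one[OF dn.segment_directions(2)[OF F(2)]] obl[OF dn.segment_directions(1)[OF F(2)]] w
          by - (rule neg, auto)
      qed
    qed
    show "finite X" by (simp add: X_def)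
  qed
  moreover have "card X \<le> Suc K"
  proof -
    have "card ((\<lambda>k. Complex (real k / M) 1) ` {1..K}) \<le> K"
      using card_image_le[of "{1..K}" "\<lambda>k. Complex (real k / M) 1"] by simp
    then show ?thesis unfolding X_def by (simp add: card_insert_if)
  qed
  ultimately show ?thesis unfolding drawable_with_slopes_def by (meson order_trans)
qed

section \<open>The slope number\<close>

lemma underlying_ugraph_eq:
  "underlying_ugraph D = \<lparr>uverts = pverts D, uedges = two_element_edges (parcs D)\<rparr>"
  by (auto simp: underlying_ugraph_def two_element_edges_def image_iff) (metis fst_conv snd_conv)+

text \<open>The ordering excludes opposite arcs, so distinct arcs at \<open>v\<close> yield distinct
  edges, and these are counted by the degree of \<open>v\<close>.\<close>

lemma incident_arcs_le_max_degree:
  fixes f :: "'a \<Rightarrow> int"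
  assumes sp: "sp_digraph D s t" and fwd: "\<And>u v. (u, v) \<in> parcs D \<Longrightarrow> f u < f v"
    and X: "X \<subseteq> parcs D" "\<And>e. e \<in> X \<Longrightarrow> v \<in> {fst e, snd e}" and v: "v \<in> pverts D"
  shows "card X \<le> max_degree (underlying_ugraph D)"
proof -
  note b = sp_digraph_basic[OF sp]
  let ?G = "underlying_ugraph D"
  have finA: "finite (parcs D)" by (rule finite_subset[OF b(5)]) (simp add: b(4))
  have "inj_on (\<lambda>e. {fst e, snd e}) X"
  proof (rule inj_onI)
    fix e e' assume "e \<in> X" "e' \<in> X" and eq: "{fst e, snd e} = {fst e', snd e'}"
    with X(1) have "e \<in> parcs D" "e' \<in> parcs D" by auto
    with eq show "e = e'"
      using fwd[of "fst e" "snd e"] fwd[of "fst e'" "snd e'"]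
      by (auto simp: doubleton_eq_iff prod_eq_iff)
  qed
  then have "card X = card ((\<lambda>e. {fst e, snd e}) ` X)" by (simp add: card_image)
  also have "\<dots> \<le> card {e \<in> uedges ?G. v \<in> e}"
  proof (rule card_mono)
    show "finite {e \<in> uedges ?G. v \<in> e}"
      using finA by (simp add: underlying_ugraph_eq two_element_edges_def)
    show "(\<lambda>e. {fst e, snd e}) ` X \<subseteq> {e \<in> uedges ?G. v \<in> e}"
      using X by (auto simp: underlying_ugraph_eq two_element_edges_def)
  qed
  also have "\<dots> = vertex_degree ?G v" by (simp add: vertex_degree_def)
  also have "\<dots> \<le> max_degree ?G"
    unfolding max_degree_def using b(4) v by (intro Max_ge) (auto simp: underlying_ugraph_eq)
  finally show ?thesis .
qed

text \<open>A single edge is drawn without a bend: the maximum degree is 1 here, whereas a bent edge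
  of the page construction would use two slopes.\<close>

lemma single_arc_drawable:
  assumes "s \<noteq> t"
  shows "drawable_with_slopes \<lparr>uverts = {s, t}, uedges = two_element_edges {(s, t)}\<rparr> 1"
proof -
  let ?G = "\<lparr>uverts = {s, t}, uedges = two_element_edges {(s, t)}\<rparr>"
  define pos :: "'a \<Rightarrow> complex" where "pos v = (if v = s then 0 else 1)" for v
  have "one_bend_planar_drawing ?G pos (\<lambda>_. None)"
    using assms by (auto simp: one_bend_planar_drawing_def two_element_edges_def inj_on_def pos_def)
  moreover have "drawing_slopes ?G pos (\<lambda>_. None) = {line_slope (affine hull (convex hull (pos ` {s, t})))}"
    by (simp add: drawing_slopes_def two_element_edges_def edge_segments_def)
  ultimately show ?thesis unfolding drawable_with_slopes_def by (intro exI[of _ pos] exI[of _ "\<lambda>_. None"]) simp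
qed

lemma sp_digraph_drawable:
  assumes sp: "sp_digraph D s t"
  shows "drawable_with_slopes (underlying_ugraph D) (max_degree (underlying_ugraph D))"
proof -
  note b = sp_digraph_basic[OF sp]
  obtain f E F where tp: "two_page D s t f E F" using sp_digraph_two_page[OF sp] by blast
  note d = two_pageD[OF tp] and strict = two_page_strict[OF tp sp]
  let ?\<Delta> = "max_degree (underlying_ugraph D)"
  have mem: "u \<in> pverts D \<and> v \<in> pverts D" if "(u, v) \<in> parcs D" for u v using that b(5) by auto
  have in_arc: "\<exists>u. (u, v) \<in> parcs D" if "v \<in> pverts D" "v \<noteq> s" for v
    using sp_digraph_source[OF sp that(1)] that(2) by auto
  have out_arc: "\<exists>w. (v, w) \<in> parcs D" if "v \<in> pverts D" "v \<noteq> t" for v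
    using sp_digraph_sink[OF sp that(1)] that(2) by auto
  have deg: "card X \<le> ?\<Delta>"
    if "X \<subseteq> parcs D" "\<And>e. e \<in> X \<Longrightarrow> v \<in> {fst e, snd e}" "v \<in> pverts D" for X v
  proof (rule incident_arcs_le_max_degree[OF sp, of f X v])
    show "f a < f c" if "(a, c) \<in> parcs D" for a c by (rule d(4)[OF that])
  qed (use that in auto)
  obtain w0 where "(s, w0) \<in> parcs D" using out_arc[OF b(1,3)] by blast
  \<comment> \<open>Positivity covers the single arc, and it makes
    \<open>Suc (?\<Delta> - 1)\<close> equal to \<open>?\<Delta>\<close> despite truncated
    subtraction.\<close>
  then have \<Delta>: "1 \<le> ?\<Delta>" using deg[of "{(s, w0)}" s] b(1) by simp
  show ?thesis
  proof (cases "pverts D = {s, t}")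
    case True
    have "parcs D \<subseteq> {(s, t)}"
    proof
      fix e assume "e \<in> parcs D"
      then show "e \<in> {(s, t)}"
        using mem[of "fst e" "snd e"] d(4)[of "fst e" "snd e"] d(2)[OF b(2)] True by (cases e) auto
    qed
    with \<open>(s, w0) \<in> parcs D\<close> have "parcs D = {(s, t)}" by auto
    then show ?thesis
      using single_arc_drawable[OF b(3)] \<Delta> True unfolding drawable_with_slopes_def underlying_ugraph_eq
      by (metis order_trans)
  next
    case False
    then obtain w where w: "w \<in> pverts D" "w \<noteq> s" "w \<noteq> t" using b(1,2) by blast
    have fin: "finite (pverts D - {v})" for v using b(4) by simp
    define x where "x = arg_min_on f (pverts D - {s})"
    have "x \<in> pverts D - {s}" unfolding x_def using w(1,2) by (intro arg_min_if_finite(1)[OF fin]) blast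
    then have x: "x \<in> pverts D" "x \<noteq> s" by auto
    have xmin: "f x \<le> f v" if "v \<in> pverts D" "v \<noteq> s" for v
      unfolding x_def using that by (intro arg_min_least[OF fin]) auto
    define y where "y = arg_min_on (\<lambda>v. - f v) (pverts D - {t})"
    have "y \<in> pverts D - {t}" unfolding y_def using w(1,3) by (intro arg_min_if_finite(1)[OF fin]) blast
    then have y: "y \<in> pverts D" "y \<noteq> t" by auto
    have ymax: "f v \<le> f y" if "v \<in> pverts D" "v \<noteq> t" for v
    proof -
      have "- f y \<le> - f v" unfolding y_def using that by (intro arg_min_least[OF fin]) auto
      then show ?thesis by simp
    qed
    \<comment> \<open>The third vertex \<open>w\<close> keeps \<open>x\<close> away from
      \<open>t\<close>, so the arcs \<open>(s, x)\<close> and \<open>(z, t)\<close> that change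
      pages below are distinct.\<close>
    have xt: "x \<noteq> t" using xmin[of w] strict(2)[of w] w by auto
    have sx: "(s, x) \<in> parcs D"
    proof -
      obtain u where u: "(u, x) \<in> parcs D" using in_arc x by blast
      \<comment> \<open>An arc into \<open>x\<close> comes from an earlier vertex, and only
        \<open>s\<close> is earlier than \<open>x\<close>.\<close>
      then have "u = s" using xmin[of u] d(4)[OF u] mem[OF u] by force
      with u show ?thesis by simp
    qed
    have yt: "(y, t) \<in> parcs D"
    proof -
      obtain u where u: "(y, u) \<in> parcs D" using out_arc y by blast
      then have "u = t" using ymax[of u] d(4)[OF u] mem[OF u] by force
      with u show ?thesis by simp
    qed
    \<comment> \<open>\<open>x\<close> and \<open>y\<close> are next to the poles in the ordering, so \<open>(s, x)\<close> and \<open>(y, t)\<close> cross nothing on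
      either page. The first page loses \<open>(s, x)\<close> and the second receives no other arc of \<open>s\<close>;
      dually at \<open>t\<close>, where the arc between the poles serves the purpose if it is present.\<close>
    define z where "z = (if (s, t) \<in> parcs D then s else y)"
    have z: "(z, t) \<in> parcs D" using yt by (simp add: z_def)
    define E' F' where "E' = insert (z, t) (E - {(s, x)})" and "F' = insert (s, x) (F - {(z, t)})"
    have un: "E' \<union> F' = parcs D"
    proof
      show "E' \<union> F' \<subseteq> parcs D" using d(13,14) z sx by (auto simp: E'_def F'_def)
      have "e \<in> E' \<union> F'" if "e \<in> E \<union> F" for e using that by (auto simp: E'_def F'_def)
      moreover have "(s, t) \<in> E' \<union> F'" if "(s, t) \<in> parcs D" using that by (simp add: E'_def z_def)
      ultimately show "parcs D \<subseteq> E' \<union> F'" unfolding d(5) by blast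
    qed
    have sub: "E' \<subseteq> parcs D" "F' \<subseteq> parcs D" using un by auto
    have "drawable_with_slopes \<lparr>uverts = pverts D, uedges = two_element_edges (E' \<union> F')\<rparr> (Suc (?\<Delta> - 1))"
    proof (rule book_embedding_drawing)
      show "finite (pverts D)" by (rule b(4))
      show "inj_on f (pverts D)" by (rule d(1))
      show "E' \<union> F' \<subseteq> pverts D \<times> pverts D" unfolding un by (rule b(5))
      show "f u < f v" if "(u, v) \<in> E' \<union> F'" for u v using that unfolding un by (rule d(4))
      show "E' \<inter> F' = {}" using d(6) xt by (auto simp: E'_def F'_def)
      have Emem: "u \<in> pverts D \<and> v \<in> pverts D" if "(u, v) \<in> E \<or> (u, v) \<in> F" for u v
        using that d(13,14) mem by blast
      show "noncrossing f E'"
      proof -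
        have "\<not> (f a < f z \<and> f z < f c \<and> f c < f t) \<and> \<not> (f z < f a \<and> f a < f t \<and> f t < f c)"
          if "(a, c) \<in> E" for a c
        proof -
          have "f s \<le> f a" "f c \<le> f t" "c \<noteq> t \<longrightarrow> f c \<le> f y"
            using Emem[of a c] that d(2)[of a] d(3)[of c] ymax[of c] by auto
          then show ?thesis by (cases "c = t") (auto simp: z_def)
        qed
        then have "noncrossing f (E \<union> {(z, t)})"
          using d(7) by (intro noncrossing_Un) (auto simp: noncrossing_def)
        then show ?thesis unfolding E'_def noncrossing_def by blast
      qed
      show "noncrossing f F'"
      proof -
        have "\<not> (f a < f s \<and> f s < f c \<and> f c < f x) \<and> \<not> (f s < f a \<and> f a < f x \<and> f x < f c)"
          if "(a, c) \<in> F" for a c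
        proof -
          have "f s \<le> f a" "a \<noteq> s \<longrightarrow> f x \<le> f a"
            using Emem[of a c] that d(2)[of a] xmin[of a] by auto
          then show ?thesis by (cases "a = s") auto
        qed
        then have "noncrossing f (F \<union> {(s, x)})"
          using d(8) by (intro noncrossing_Un) (auto simp: noncrossing_def)
        then show ?thesis unfolding F'_def noncrossing_def by blast
      qed
      show "inj_on snd E'"
      proof (rule inj_on_sndI)
        fix a c v assume "(a, v) \<in> E'" "(c, v) \<in> E'"
        then show "a = c"
          using d(11) inj_onD[OF d(9), of "(a, v)" "(c, v)"] by (auto simp: E'_def)
      qed
      show "inj_on fst F'"
      proof (rule inj_on_fstI)
        fix a c v assume "(v, a) \<in> F'" "(v, c) \<in> F'"
        then show "a = c"
          using d(12) inj_onD[OF d(10), of "(v, a)" "(v, c)"] by (auto simp: F'_def)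
      qed
      \<comment> \<open>An arc \<open>e0\<close> at \<open>v\<close> outside the fan
        \<open>X\<close> uses up one of the at most \<open>?\<Delta>\<close> arcs at
        \<open>v\<close>.\<close>
      have bound: "card X \<le> ?\<Delta> - 1"
        if "X \<subseteq> parcs D" "\<And>e. e \<in> X \<Longrightarrow> v \<in> {fst e, snd e}" "v \<in> pverts D"
          "e0 \<in> parcs D" "v \<in> {fst e0, snd e0}" "e0 \<notin> X" for X v e0
      proof -
        have "card (insert e0 X) \<le> ?\<Delta>" by (rule deg[of _ v]) (use that in auto)
        moreover have "finite (parcs D)" by (rule finite_subset[OF b(5)]) (simp add: b(4))
        then have "finite X" using that(1) finite_subset by blast
        ultimately show ?thesis using that(6) by simp
      qed
      show "card {v. (u, v) \<in> E'} \<le> ?\<Delta> - 1" for u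
      proof (cases "u \<in> pverts D")
        case True
        \<comment> \<open>At \<open>s\<close> the arc outside the fan is \<open>(s, x)\<close>,
          which is not on the first page; at any other vertex it is an incoming arc.\<close>
        have "\<exists>e0 \<in> parcs D. u \<in> {fst e0, snd e0} \<and> e0 \<notin> Pair u ` {v. (u, v) \<in> E'}"
        proof (cases "u = s")
          case True
          have "(s, x) \<notin> E'" using xt by (simp add: E'_def)
          then show ?thesis using sx True by (intro bexI[of _ "(s, x)"]) auto
        next
          case False
          obtain a where a: "(a, u) \<in> parcs D" using in_arc \<open>u \<in> pverts D\<close> False by blast
          with b(6)[of u] show ?thesis by (intro bexI[of _ "(a, u)"]) auto
        qed
        then obtain e0 where "e0 \<in> parcs D" "u \<in> {fst e0, snd e0}" "e0 \<notin> Pair u ` {v. (u, v) \<in> E'}"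
          by blast
        then have "card (Pair u ` {v. (u, v) \<in> E'}) \<le> ?\<Delta> - 1"
          using sub(1) True by (intro bound[of _ u e0]) auto
        then show ?thesis by (simp add: card_image inj_on_def)
      next
        case False
        then have "{v. (u, v) \<in> E'} = {}" using sub(1) mem by blast
        then show ?thesis by simp
      qed
      show "card {u. (u, v) \<in> F'} \<le> ?\<Delta> - 1" for v
      proof (cases "v \<in> pverts D")
        case True
        \<comment> \<open>Dually, at \<open>t\<close> it is \<open>(z, t)\<close>, which is not on
          the second page; at any other vertex it is an outgoing arc.\<close>
        have "\<exists>e0 \<in> parcs D. v \<in> {fst e0, snd e0} \<and> e0 \<notin> (\<lambda>u. (u, v)) ` {u. (u, v) \<in> F'}"
        proof (cases "v = t")
          case True
          have "(z, t) \<notin> F'" using xt by (simp add: F'_def)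
          then show ?thesis using z True by (intro bexI[of _ "(z, t)"]) auto
        next
          case False
          obtain a where a: "(v, a) \<in> parcs D" using out_arc \<open>v \<in> pverts D\<close> False by blast
          with b(6)[of v] show ?thesis by (intro bexI[of _ "(v, a)"]) auto
        qed
        then obtain e0 where "e0 \<in> parcs D" "v \<in> {fst e0, snd e0}" "e0 \<notin> (\<lambda>u. (u, v)) ` {u. (u, v) \<in> F'}"
          by blast
        then have "card ((\<lambda>u. (u, v)) ` {u. (u, v) \<in> F'}) \<le> ?\<Delta> - 1"
          using sub(2) True by (intro bound[of _ v e0]) auto
        then show ?thesis by (simp add: card_image inj_on_def)
      next
        case False
        then have "{u. (u, v) \<in> F'} = {}" using sub(2) mem by blast
        then show ?thesis by simp
      qed
    qed
    then show ?thesis using \<Delta> by (simp add: un underlying_ugraph_eq)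
  qed
qed

theorem corollary1:
  fixes \<Delta> :: nat
  shows "one_bend_planar_slope_number {G :: 'a ugraph. sp_graph G \<and> max_degree G = \<Delta>} \<le> enat \<Delta> \<and>
    (\<forall>G :: 'a ugraph. sp_graph G \<and> max_degree G = \<Delta> \<longrightarrow>
      (\<exists>pos bend. one_bend_planar_drawing G pos bend \<and>
        finite (drawing_slopes G pos bend) \<and> card (drawing_slopes G pos bend) \<le> \<Delta>))"
proof -
  have dr: "drawable_with_slopes G \<Delta>" if "sp_graph G" "max_degree G = \<Delta>" for G :: "'a ugraph"
    using that sp_digraph_drawable unfolding sp_graph_def by metis
  then have "one_bend_planar_slope_number {G :: 'a ugraph. sp_graph G \<and> max_degree G = \<Delta>} \<le> enat \<Delta>"
    unfolding one_bend_planar_slope_number_def by (intro Inf_lower) auto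
  with dr show ?thesis unfolding drawable_with_slopes_def by blast
qed

end
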